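(* Let $(\bar\gamma,\bar\tau)\in H^1(0,T;\mathbb{R}^2)\times\mathbb{R}$ be feasible, i.e. $\mathcal{G}(\bar\gamma,\bar\tau)\in\mathcal{K}$ (equivalently $\bar\gamma\in U_{\mathrm{ad}}$, $\bar\tau\in[3r,T]$). (a) The Robinson–Zowe–Kurcyusz condition holds at $(\bar\gamma,\bar\tau)$: $$H^1(0,T)\times\mathbb{R}=D\mathcal{G}(\bar\gamma,\bar\tau)(H^1(0,T;\mathbb{R}^2)\times\mathbb{R})-\mathcal{R}_{\mathcal{K}}(\mathcal{G}(\bar\gamma,\bar\tau)).$$ (b) If moreover $(\bar\gamma,\bar\tau)$ satisfies the first-order necessary conditions $D_\gamma\hat J_r(\bar\gamma,\bar\tau)\delta\gamma\ge0$ for all $\delta\gamma\in\mathcal{T}_{U_{\mathrm{ad}}}(\bar\gamma)$ and $D_\tau\hat J_r(\bar\gamma,\bar\tau)(s-\bar\tau)\ge0$ for all $s\in[3r,T]$, then there exists a Lagrange multiplier $(\bar\lambda,\bar\mu)$ at $(\bar\gamma,\bar\tau)$, the strict Robinson–Zowe–Kurcyusz condition $$H^1(0,T)\times\mathbb{R}=D\mathcal{G}(\bar\gamma,\bar\tau)(H^1(0,T;\mathbb{R}^2)\times\mathbb{R})-\left(\mathcal{R}_{\mathcal{K}}(\mathcal{G}(\bar\gamma,\bar\tau))\cap(\bar\lambda,\bar\mu)^\perp\right)$$ holds, and consequently the Lagrange multiplier at $(\bar\gamma,\bar\tau)$ is unique.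
   Context: Setting. $\Omega\subset\mathbb{R}^3$ is a bounded Lipschitz domain with boundary $\Gamma=\bar\Gamma_1\cup\bar\Gamma_2\cup\bar\Gamma_3$, where $\Gamma_1,\Gamma_2,\Gamma_3$ are disjoint open subsets of $\Gamma$; $\Gamma_1$ lies in the plane $\{x_3=0\}$, identified with $\mathbb{R}^2$, and every $x\in\Omega$ with $(x_1,x_2)\in\Gamma_1$ has $x_3<0$. $T>0$, $r\in\,]0,T/3[$; $Q=\Omega\times]0,T[$, $\Sigma_i=\Gamma_i\times]0,T[$. $\Gamma_S\subset\Gamma_1$ is a non-empty compact set and $\Gamma_S=\{x\in\mathbb{R}^2: g(x)\le 0\}$ for a function $g:\mathbb{R}^2\to\mathbb{R}$ of class $C^3$ with $g'(x)\ne0$ whenever $g(x)=0$. The set of admissible paths is $U_{\mathrm{ad}}=\{\gamma\in H^1(0,T;\mathbb{R}^2): g(\gamma(t))\le0\ \forall t\in[0,T]\}$. State equation. $\rho,c,\kappa,h,\alpha,P,R>0$ are constants, $y_0\in L^2(\Omega)$, $y_B\in L^2(\Sigma_3)$. $W(0,T)=\{u\in L^2(0,T;H^1(\Omega)): u'\in L^2(0,T;H^1(\Omega)^\star)\}$. For $\gamma\in H^1(0,T;\mathbb{R}^2)$ let $g_\gamma(x,t)=\alpha\frac{2P}{\pi R^2}\exp(-2|x-\gamma(t)|^2/R^2)$, $(x,t)\in\Sigma_1$, and let $S(\gamma)=y_\gamma\in W(0,T)$ be the unique weak solution of $\rho c\,\partial_t y-\kappa\Delta y=0$ in $Q$, $-\kappa\partial_\nu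 y=hy-g_\gamma$ on $\Sigma_1$, $-\kappa\partial_\nu y=hy$ on $\Sigma_2$, $-\kappa\partial_\nu y=h(y-y_B)$ on $\Sigma_3$, $y(0)=y_0$. Cost. $\lambda_Q,\lambda_\Omega,\lambda_\gamma>0$, $\beta_T\ge0$, $y_Q,y_\Omega\in C([0,T];L^2(\Omega))$. The reduced cost functional $\hat J_r:H^1(0,T;\mathbb{R}^2)\times[3r,T]\to\mathbb{R}$ is, with $y=S(\gamma)$, $$\hat J_r(\gamma,\tau)=\frac{\lambda_Q}{2r}\int_{\frac\tau2-\frac r2}^{\frac\tau2+\frac r2}\!\int_\Omega|y-y_Q|^2dx\,dt+\frac{\lambda_\Omega}{2r}\int_{\tau-r}^{\tau}\!\int_\Omega|y-y_\Omega|^2dx\,dt+\frac12\int_0^T\!\!\int_\Omega|\nabla y|^2dx\,dt+\frac{\lambda_\gamma}{2}\int_0^T|\dot\gamma|^2dt+\beta_T\tau.$$ It is known to be continuously Fréchet differentiable ($\tau$-derivatives at $\tau=3r$ and $\tau=T$ are one-sided). Constraint, cones, multipliers. $G:H^1(0,T;\mathbb{R}^2)\to H^1(0,T)$, $G(\gamma)=g\circ\gamma$, with $DG(\gamma)\delta\gamma=g'(\gamma)\delta\gamma$; $K=\{v\in H^1(0,T): v\le0\}$; $\mathcal{G}:H^1(0,T;\mathbb{R}^2)\times\mathbb{R}\to H^1(0,T)\times\mathbb{R}$, $\mathcal{G}(\gamma,\tau)=(G(\gamma),\tau)$; $\mathcal{K}=K\times[3r,T]$. For a closed convex set $C$ in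 a Banach space $Y$ and $y\in C$: $\mathcal{R}_C(y)=\{s(z-y):z\in C,\ s\ge0\}$ (radial cone) and $\mathcal{N}_C(y)=\{\ell\in Y^\star:\langle\ell,z-y\rangle\le0\ \forall z\in C\}$ (normal cone); for $\ell\in Y^\star$, $\ell^\perp=\{z\in Y:\langle\ell,z\rangle=0\}$. For a subset $U$ of a normed space $V$ and $u\in U$, the tangent cone $\mathcal{T}_U(u)$ is the set of $d\in V$ for which there exist $u_n\in U$, $u_n\to u$, and $t_n>0$, $t_n\to0$, with $(u_n-u)/t_n\to d$. A pair $(\bar\lambda,\bar\mu)\in H^1(0,T)^\star\times\mathbb{R}$ is a Lagrange multiplier at a feasible $(\bar\gamma,\bar\tau)$ if $\bar\lambda\in\mathcal{N}_K(G(\bar\gamma))$, $\bar\mu\in\mathcal{N}_{[3r,T]}(\bar\tau)$, $D_\gamma\hat J_r(\bar\gamma,\bar\tau)+DG(\bar\gamma)^\star\bar\lambda=0$ and $D_\tau\hat J_r(\bar\gamma,\bar\tau)+\bar\mu=0$. *)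

theory Defs
  imports "HOL-Analysis.Analysis" "HOL-Library.Function_Algebras"
begin

section \<open>Normed spaces given by a carrier set\<close>

text \<open>The spaces below depend on real parameters (the final time) and on sets (the domain), so they
  cannot be types. A (semi)normed space is represented by a subspace \<open>V\<close> of an ambient real vector
  space together with a (semi)norm \<open>N\<close> on \<open>V\<close>. Function spaces use pointwise operations.\<close>

instantiation "fun" :: (type, real_vector) real_vector
begin

definition scaleR_fun :: "real \<Rightarrow> ('a \<Rightarrow> 'b) \<Rightarrow> 'a \<Rightarrow> 'b"
  where "scaleR_fun a f = (\<lambda>x. a *\<^sub>R f x)"

instance
  by standard (auto simp: scaleR_fun_def fun_eq_iff algebra_simps)

end

text \<open>Functionals are normalised to vanish off the carrier, so that equal functionals on \<open>V\<close> are
  equal as functions.\<close>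

definition dual :: "'v::real_vector set \<Rightarrow> ('v \<Rightarrow> real) \<Rightarrow> ('v \<Rightarrow> real) set"
  where "dual V N = {l. (\<forall>x\<in>V. \<forall>y\<in>V. l (x + y) = l x + l y) \<and> (\<forall>a. \<forall>x\<in>V. l (a *\<^sub>R x) = a * l x)
    \<and> (\<exists>C. \<forall>x\<in>V. \<bar>l x\<bar> \<le> C * N x) \<and> (\<forall>x. x \<notin> V \<longrightarrow> l x = 0)}"

definition dual_norm :: "'v::real_vector set \<Rightarrow> ('v \<Rightarrow> real) \<Rightarrow> ('v \<Rightarrow> real) \<Rightarrow> real"
  where "dual_norm V N l = (SUP x\<in>{x\<in>V. N x \<le> 1}. \<bar>l x\<bar>)"

definition radial_cone :: "'v::real_vector set \<Rightarrow> 'v \<Rightarrow> 'v set"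
  where "radial_cone C y = {s *\<^sub>R (z - y) | s z. z \<in> C \<and> 0 \<le> s}"

definition normal_cone ::
    "'v::real_vector set \<Rightarrow> ('v \<Rightarrow> real) \<Rightarrow> 'v set \<Rightarrow> 'v \<Rightarrow> ('v \<Rightarrow> real) set"
  where "normal_cone V N C y = {l \<in> dual V N. \<forall>z\<in>C. l (z - y) \<le> 0}"

definition tangent_cone ::
    "'v::real_vector set \<Rightarrow> ('v \<Rightarrow> real) \<Rightarrow> 'v set \<Rightarrow> 'v \<Rightarrow> 'v set"
  where "tangent_cone V N U u = {d \<in> V. \<exists>w t. (\<forall>n. w n \<in> U) \<and> (\<lambda>n. N (w n - u)) \<longlonglongrightarrow> 0
    \<and> (\<forall>n. 0 < t n) \<and> t \<longlonglongrightarrow> (0::real) \<and> (\<lambda>n. N ((1 / t n) *\<^sub>R (w n - u) - d)) \<longlonglongrightarrow> 0}"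

definition minkowski_diff :: "'v::real_vector set \<Rightarrow> 'v set \<Rightarrow> 'v set"
  where "minkowski_diff A B = {a - b | a b. a \<in> A \<and> b \<in> B}"

text \<open>Frechet derivative at \<open>x\<close> of a functional defined on \<open>S \<subseteq> V\<close>; increments stay inside \<open>S\<close>, which
  gives one-sided derivatives at boundary points of \<open>S\<close>.\<close>

definition has_frechet_on ::
    "'v::real_vector set \<Rightarrow> ('v \<Rightarrow> real) \<Rightarrow> 'v set \<Rightarrow> ('v \<Rightarrow> real) \<Rightarrow> ('v \<Rightarrow> real) \<Rightarrow> 'v \<Rightarrow> bool"
  where "has_frechet_on V N S f f' x \<longleftrightarrow> f' \<in> dual V N \<and>
    (\<forall>\<epsilon>>0. \<exists>\<delta>>0. \<forall>y\<in>S. N (y - x) < \<delta> \<longrightarrow> \<bar>f y - f x - f' (y - x)\<bar> \<le> \<epsilon> * N (y - x))"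

definition frechet_on ::
    "'v::real_vector set \<Rightarrow> ('v \<Rightarrow> real) \<Rightarrow> 'v set \<Rightarrow> ('v \<Rightarrow> real) \<Rightarrow> 'v \<Rightarrow> 'v \<Rightarrow> real"
  where "frechet_on V N S f x = (SOME f'. has_frechet_on V N S f f' x)"

definition cont_frechet_differentiable_on ::
    "'v::real_vector set \<Rightarrow> ('v \<Rightarrow> real) \<Rightarrow> 'v set \<Rightarrow> ('v \<Rightarrow> real) \<Rightarrow> bool"
  where "cont_frechet_differentiable_on V N S f \<longleftrightarrow>
    (\<exists>f'. (\<forall>x\<in>S. has_frechet_on V N S f (f' x) x) \<and>
      (\<forall>x\<in>S. \<forall>\<epsilon>>0. \<exists>\<delta>>0. \<forall>y\<in>S. N (y - x) < \<delta> \<longrightarrow> dual_norm V N (f' y - f' x) < \<epsilon>))"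

definition continuous_into :: "real set \<Rightarrow> 'v::real_vector set \<Rightarrow> ('v \<Rightarrow> real) \<Rightarrow> (real \<Rightarrow> 'v) set"
  where "continuous_into I V N = {u. (\<forall>t\<in>I. u t \<in> V) \<and>
    (\<forall>t\<in>I. ((\<lambda>s. N (u s - u t)) \<longlongrightarrow> 0) (at t within I))}"

text \<open>Bochner space \<open>L\<^sup>2(I; V)\<close>: strongly measurable (almost everywhere limit of simple functions)
  with square integrable norm.\<close>

definition bochner_L2 :: "real set \<Rightarrow> 'v::real_vector set \<Rightarrow> ('v \<Rightarrow> real) \<Rightarrow> (real \<Rightarrow> 'v) set"
  where "bochner_L2 I V N = {u. (AE t in lebesgue_on I. u t \<in> V) \<and>
    (\<exists>s. (\<forall>n. simple_function (lebesgue_on I) (s n) \<and> (\<forall>t\<in>I. s n t \<in> V)) \<and>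
         (AE t in lebesgue_on I. (\<lambda>n. N (s n t - u t)) \<longlonglongrightarrow> 0)) \<and>
    integrable (lebesgue_on I) (\<lambda>t. (N (u t))\<^sup>2)}"


section \<open>Lebesgue and Sobolev spaces\<close>

definition L2 :: "'a measure \<Rightarrow> ('a \<Rightarrow> 'b::euclidean_space) set"
  where "L2 M = {f \<in> borel_measurable M. integrable M (\<lambda>x. (norm (f x))\<^sup>2)}"

definition L2_norm :: "'a measure \<Rightarrow> ('a \<Rightarrow> 'b::euclidean_space) \<Rightarrow> real"
  where "L2_norm M f = sqrt (LINT x|M. (norm (f x))\<^sup>2)"

text \<open>\<open>f \<in> C\<^sup>k\<close> in finite dimensions: all iterated directional derivatives up to order \<open>k\<close> exist
  and are continuous.\<close>

primrec C_class :: "nat \<Rightarrow> ('a::euclidean_space \<Rightarrow> real) \<Rightarrow> bool"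
  where "C_class 0 f = continuous_on UNIV f"
  | "C_class (Suc k) f = ((\<forall>x. f differentiable (at x)) \<and>
       (\<forall>v. C_class k (\<lambda>x. frechet_derivative f (at x) v)))"

text \<open>Test functions of class \<open>C\<^sup>1\<close> with compact support give the same weak derivatives as smooth ones
  (by mollification).\<close>

definition test_functions :: "'a::euclidean_space set \<Rightarrow> ('a \<Rightarrow> real) set"
  where "test_functions D = {\<phi>. C_class 1 \<phi> \<and> compact (closure {x. \<phi> x \<noteq> 0}) \<and>
    closure {x. \<phi> x \<noteq> 0} \<subseteq> D}"

definition has_weak_deriv ::
    "'a::euclidean_space set \<Rightarrow> 'a \<Rightarrow> ('a \<Rightarrow> 'b::euclidean_space) \<Rightarrow> ('a \<Rightarrow> 'b) \<Rightarrow> bool"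
  where "has_weak_deriv D e u w \<longleftrightarrow> (\<forall>\<phi>\<in>test_functions D.
    (LINT x|lebesgue_on D. frechet_derivative \<phi> (at x) e *\<^sub>R u x) =
      - (LINT x|lebesgue_on D. \<phi> x *\<^sub>R w x))"

definition weak_deriv ::
    "'a::euclidean_space set \<Rightarrow> 'a \<Rightarrow> ('a \<Rightarrow> 'b::euclidean_space) \<Rightarrow> 'a \<Rightarrow> 'b"
  where "weak_deriv D e u = (SOME w. w \<in> L2 (lebesgue_on D) \<and> has_weak_deriv D e u w)"

definition H1 :: "'a::euclidean_space set \<Rightarrow> ('a \<Rightarrow> 'b::euclidean_space) set"
  where "H1 D = {u \<in> L2 (lebesgue_on D).
    \<forall>e\<in>Basis. \<exists>w\<in>L2 (lebesgue_on D). has_weak_deriv D e u w}"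

definition H1_norm :: "'a::euclidean_space set \<Rightarrow> ('a \<Rightarrow> 'b::euclidean_space) \<Rightarrow> real"
  where "H1_norm D u = sqrt ((LINT x|lebesgue_on D. (norm (u x))\<^sup>2) +
    (\<Sum>e\<in>Basis. LINT x|lebesgue_on D. (norm (weak_deriv D e u x))\<^sup>2))"

text \<open>\<open>H\<^sup>1(0,T)\<close>: every class has exactly one representative that is continuous on \<open>[0,T]\<close> and
  vanishes outside.\<close>

definition H1T :: "real \<Rightarrow> (real \<Rightarrow> 'b::euclidean_space) set"
  where "H1T T = {u \<in> H1 {0<..<T}. continuous_on {0..T} u \<and> (\<forall>t. t \<notin> {0..T} \<longrightarrow> u t = 0)}"

abbreviation H1T_norm :: "real \<Rightarrow> (real \<Rightarrow> 'b::euclidean_space) \<Rightarrow> real"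
  where "H1T_norm T \<equiv> H1_norm {0<..<T}"

text \<open>The product \<open>H\<^sup>1(0,T) \<times> \<real>\<close>.\<close>

abbreviation H1R :: "real \<Rightarrow> ((real \<Rightarrow> 'b::euclidean_space) \<times> real) set"
  where "H1R T \<equiv> H1T T \<times> UNIV"

definition H1R_norm :: "real \<Rightarrow> (real \<Rightarrow> 'b::euclidean_space) \<times> real \<Rightarrow> real"
  where "H1R_norm T p = sqrt ((H1T_norm T (fst p))\<^sup>2 + (snd p)\<^sup>2)"


section \<open>Lipschitz domains, surface measure and traces\<close>

definition proj2 :: "real^3 \<Rightarrow> real^2"
  where "proj2 x = vector [x $ 1, x $ 2]"

definition embed3 :: "real^2 \<Rightarrow> real^3"
  where "embed3 p = vector [p $ 1, p $ 2, 0]"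

definition lipschitz_domain :: "(real^3) set \<Rightarrow> bool"
  where "lipschitz_domain \<Omega> \<longleftrightarrow> open \<Omega> \<and> connected \<Omega> \<and> \<Omega> \<noteq> {} \<and>
    (\<forall>p\<in>frontier \<Omega>. \<exists>A \<psi> L \<epsilon>. orthogonal_transformation A \<and> L-lipschitz_on UNIV \<psi> \<and> 0 < \<epsilon> \<and>
      \<Omega> \<inter> ball p \<epsilon> = {x \<in> ball p \<epsilon>. A (x - p) $ 3 < \<psi> (proj2 (A (x - p)))})"

text \<open>Two-dimensional Hausdorff measure, normalised by \<open>\<pi>/4\<close> so that it is surface area. It is a
  metric outer measure, so \<open>measure_of\<close> on the Borel sets really yields it.\<close>

definition hausdorff2_pre :: "real \<Rightarrow> (real^3) set \<Rightarrow> ennreal"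
  where "hausdorff2_pre \<delta> A =
    (INF C\<in>{C :: nat \<Rightarrow> (real^3) set. A \<subseteq> (\<Union>i. C i) \<and> (\<forall>i. bounded (C i) \<and> diameter (C i) \<le> \<delta>)}.
      \<Sum>i. ennreal (pi / 4 * (diameter (C i))\<^sup>2))"

definition hausdorff2 :: "(real^3) set \<Rightarrow> ennreal"
  where "hausdorff2 A = (SUP \<delta>\<in>{0<..}. hausdorff2_pre \<delta> A)"

definition surface_measure_on :: "(real^3) set \<Rightarrow> (real^3) measure"
  where "surface_measure_on \<Gamma> = restrict_space (measure_of UNIV (sets borel) hausdorff2) \<Gamma>"

text \<open>The trace is the continuous extension of the restriction map, defined on functions that are
  smooth up to the boundary; these are dense in \<open>H\<^sup>1(\<Omega>)\<close> for Lipschitz domains.\<close>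

definition is_trace :: "(real^3) set \<Rightarrow> (real^3 \<Rightarrow> real) \<Rightarrow> (real^3 \<Rightarrow> real) \<Rightarrow> bool"
  where "is_trace \<Omega> v w \<longleftrightarrow> w \<in> L2 (surface_measure_on (frontier \<Omega>)) \<and>
    (\<exists>f. (\<forall>n. C_class 1 (f n)) \<and> (\<lambda>n. H1_norm \<Omega> (f n - v)) \<longlonglongrightarrow> 0 \<and>
      (\<lambda>n. L2_norm (surface_measure_on (frontier \<Omega>)) (f n - w)) \<longlonglongrightarrow> 0)"

definition trace_of :: "(real^3) set \<Rightarrow> (real^3 \<Rightarrow> real) \<Rightarrow> real^3 \<Rightarrow> real"
  where "trace_of \<Omega> v = (SOME w. is_trace \<Omega> v w)"


section \<open>The path optimization problem\<close>

record path_problem =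
  Omega :: "(real^3) set"
  Gamma1 :: "(real^3) set"
  Gamma2 :: "(real^3) set"
  Gamma3 :: "(real^3) set"
  final_time :: real                     \<comment> \<open>\<open>T\<close>\<close>
  window :: real                         \<comment> \<open>\<open>r\<close>\<close>
  level_fun :: "real^2 \<Rightarrow> real"          \<comment> \<open>\<open>g\<close>\<close>
  mass_density :: real                   \<comment> \<open>\<open>\<rho>\<close>\<close>
  heat_capacity :: real                  \<comment> \<open>\<open>c\<close>\<close>
  conductivity :: real                   \<comment> \<open>\<open>\<kappa>\<close>\<close>
  transfer :: real                       \<comment> \<open>\<open>h\<close>\<close>
  absorption :: real                     \<comment> \<open>\<open>\<alpha>\<close>\<close>
  laser_power :: real                    \<comment> \<open>\<open>P\<close>\<close>
  laser_radius :: real                   \<comment> \<open>\<open>R\<close>\<close>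
  y_init :: "real^3 \<Rightarrow> real"
  y_B :: "(real^3) \<times> real \<Rightarrow> real"
  lam_Q :: real
  lam_Omega :: real
  lam_gamma :: real
  beta_T :: real
  y_Q :: "real \<Rightarrow> real^3 \<Rightarrow> real"
  y_Omega :: "real \<Rightarrow> real^3 \<Rightarrow> real"

definition standing_assumptions :: "path_problem \<Rightarrow> bool"
  where "standing_assumptions D \<longleftrightarrow>
    bounded (Omega D) \<and> lipschitz_domain (Omega D) \<and>
    (\<forall>\<Gamma>\<in>{Gamma1 D, Gamma2 D, Gamma3 D}. openin (top_of_set (frontier (Omega D))) \<Gamma>) \<and>
    Gamma1 D \<inter> Gamma2 D = {} \<and> Gamma1 D \<inter> Gamma3 D = {} \<and> Gamma2 D \<inter> Gamma3 D = {} \<and>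
    frontier (Omega D) = closure (Gamma1 D) \<union> closure (Gamma2 D) \<union> closure (Gamma3 D) \<and>
    (\<forall>x\<in>Gamma1 D. x $ 3 = 0) \<and>
    (\<forall>x\<in>Omega D. embed3 (proj2 x) \<in> Gamma1 D \<longrightarrow> x $ 3 < 0) \<and>
    0 < final_time D \<and> 0 < window D \<and> window D < final_time D / 3 \<and>
    C_class 3 (level_fun D) \<and>
    (\<forall>x. level_fun D x = 0 \<longrightarrow> frechet_derivative (level_fun D) (at x) \<noteq> (\<lambda>_. 0)) \<and>
    compact {x. level_fun D x \<le> 0} \<and> {x. level_fun D x \<le> 0} \<noteq> {} \<and>
    embed3 ` {x. level_fun D x \<le> 0} \<subseteq> Gamma1 D \<and>
    0 < mass_density D \<and> 0 < heat_capacity D \<and> 0 < conductivity D \<and> 0 < transfer D \<and>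
    0 < absorption D \<and> 0 < laser_power D \<and> 0 < laser_radius D \<and>
    y_init D \<in> L2 (lebesgue_on (Omega D)) \<and>
    y_B D \<in> L2 (surface_measure_on (Gamma3 D) \<Otimes>\<^sub>M lebesgue_on {0<..<final_time D}) \<and>
    0 < lam_Q D \<and> 0 < lam_Omega D \<and> 0 < lam_gamma D \<and> 0 \<le> beta_T D \<and>
    y_Q D \<in> continuous_into {0..final_time D} (L2 (lebesgue_on (Omega D))) (L2_norm (lebesgue_on (Omega D))) \<and>
    y_Omega D \<in> continuous_into {0..final_time D} (L2 (lebesgue_on (Omega D))) (L2_norm (lebesgue_on (Omega D)))"

subsection \<open>State equation\<close>

text \<open>Time derivative in \<open>L\<^sup>2(0,T; H\<^sup>1(\<Omega>)\<^sup>\<star>)\<close>, with \<open>H\<^sup>1(\<Omega>)\<close> embedded into its dual through the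
  inner product of \<open>L\<^sup>2(\<Omega>)\<close>.\<close>

definition has_time_deriv :: "(real^3) set \<Rightarrow> real \<Rightarrow> (real \<Rightarrow> real^3 \<Rightarrow> real) \<Rightarrow>
    (real \<Rightarrow> (real^3 \<Rightarrow> real) \<Rightarrow> real) \<Rightarrow> bool"
  where "has_time_deriv \<Omega> T y y' \<longleftrightarrow>
    y' \<in> bochner_L2 {0<..<T} (dual (H1 \<Omega>) (H1_norm \<Omega>)) (dual_norm (H1 \<Omega>) (H1_norm \<Omega>)) \<and>
    (\<forall>v\<in>H1 \<Omega>. has_weak_deriv {0<..<T} 1 (\<lambda>t. LINT x|lebesgue_on \<Omega>. y t x * v x) (\<lambda>t. y' t v))"

definition W_space :: "(real^3) set \<Rightarrow> real \<Rightarrow> (real \<Rightarrow> real^3 \<Rightarrow> real) set"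
  where "W_space \<Omega> T = {y \<in> bochner_L2 {0<..<T} (H1 \<Omega>) (H1_norm \<Omega>). \<exists>y'. has_time_deriv \<Omega> T y y'}"

text \<open>Initial value of the representative in \<open>C([0,T]; L\<^sup>2(\<Omega>))\<close>.\<close>

definition has_initial_value ::
    "(real^3) set \<Rightarrow> real \<Rightarrow> (real \<Rightarrow> real^3 \<Rightarrow> real) \<Rightarrow> (real^3 \<Rightarrow> real) \<Rightarrow> bool"
  where "has_initial_value \<Omega> T y y0 \<longleftrightarrow>
    (\<exists>z\<in>continuous_into {0..T} (L2 (lebesgue_on \<Omega>)) (L2_norm (lebesgue_on \<Omega>)).
      (AE t in lebesgue_on {0<..<T}. AE x in lebesgue_on \<Omega>. z t x = y t x) \<and>
      (AE x in lebesgue_on \<Omega>. z 0 x = y0 x))"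

definition laser_source :: "path_problem \<Rightarrow> (real \<Rightarrow> real^2) \<Rightarrow> real^3 \<Rightarrow> real \<Rightarrow> real"
  where "laser_source D \<gamma> x t = absorption D * (2 * laser_power D / (pi * (laser_radius D)\<^sup>2)) *
    exp (- 2 * (norm (proj2 x - \<gamma> t))\<^sup>2 / (laser_radius D)\<^sup>2)"

definition weak_solution ::
    "path_problem \<Rightarrow> (real \<Rightarrow> real^2) \<Rightarrow> (real \<Rightarrow> real^3 \<Rightarrow> real) \<Rightarrow> bool"
  where "weak_solution D \<gamma> y \<longleftrightarrow> (let \<Omega> = Omega D; T = final_time D; tr = trace_of \<Omega> in
    y \<in> W_space \<Omega> T \<and> has_initial_value \<Omega> T y (y_init D) \<and>
    (\<exists>y'. has_time_deriv \<Omega> T y y' \<and>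
      (AE t in lebesgue_on {0<..<T}. \<forall>v\<in>H1 \<Omega>.
        mass_density D * heat_capacity D * y' t v
        + conductivity D *
            (LINT x|lebesgue_on \<Omega>. (\<Sum>e\<in>Basis. weak_deriv \<Omega> e (y t) x * weak_deriv \<Omega> e v x))
        + transfer D * (LINT x|surface_measure_on (Gamma1 D). tr (y t) x * tr v x)
        + transfer D * (LINT x|surface_measure_on (Gamma2 D). tr (y t) x * tr v x)
        + transfer D * (LINT x|surface_measure_on (Gamma3 D). tr (y t) x * tr v x)
        = (LINT x|surface_measure_on (Gamma1 D). laser_source D \<gamma> x t * tr v x)
        + transfer D * (LINT x|surface_measure_on (Gamma3 D). y_B D (x, t) * tr v x))))"

text \<open>Weak solutions exist and are unique up to null sets; the cost below does not depend on the
  representative.\<close>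

definition state :: "path_problem \<Rightarrow> (real \<Rightarrow> real^2) \<Rightarrow> real \<Rightarrow> real^3 \<Rightarrow> real"
  where "state D \<gamma> = (SOME y. weak_solution D \<gamma> y)"

subsection \<open>Reduced cost functional\<close>

definition reduced_cost :: "path_problem \<Rightarrow> (real \<Rightarrow> real^2) \<times> real \<Rightarrow> real"
  where "reduced_cost D = (\<lambda>(\<gamma>, \<tau>).
    (let \<Omega> = Omega D; T = final_time D; r = window D; y = state D \<gamma> in
      lam_Q D / (2 * r) * (LINT t|lebesgue_on {\<tau> / 2 - r / 2..\<tau> / 2 + r / 2}.
        LINT x|lebesgue_on \<Omega>. (y t x - y_Q D t x)\<^sup>2)
      + lam_Omega D / (2 * r) * (LINT t|lebesgue_on {\<tau> - r..\<tau>}.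
        LINT x|lebesgue_on \<Omega>. (y t x - y_Omega D t x)\<^sup>2)
      + 1 / 2 * (LINT t|lebesgue_on {0<..<T}.
        LINT x|lebesgue_on \<Omega>. (\<Sum>e\<in>Basis. (weak_deriv \<Omega> e (y t) x)\<^sup>2))
      + lam_gamma D / 2 * (LINT t|lebesgue_on {0<..<T}. (norm (weak_deriv {0<..<T} 1 \<gamma> t))\<^sup>2)
      + beta_T D * \<tau>))"

abbreviation stop_times :: "path_problem \<Rightarrow> real set"
  where "stop_times D \<equiv> {3 * window D..final_time D}"

definition reduced_cost_C1 :: "path_problem \<Rightarrow> bool"
  where "reduced_cost_C1 D \<longleftrightarrow> cont_frechet_differentiable_on (H1R (final_time D))
    (H1R_norm (final_time D)) (H1T (final_time D) \<times> stop_times D) (reduced_cost D)"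

definition D_cost :: "path_problem \<Rightarrow> (real \<Rightarrow> real^2) \<times> real \<Rightarrow> (real \<Rightarrow> real^2) \<times> real \<Rightarrow> real"
  where "D_cost D p = frechet_on (H1R (final_time D)) (H1R_norm (final_time D))
    (H1T (final_time D) \<times> stop_times D) (reduced_cost D) p"

definition D_gamma :: "path_problem \<Rightarrow> (real \<Rightarrow> real^2) \<times> real \<Rightarrow> (real \<Rightarrow> real^2) \<Rightarrow> real"
  where "D_gamma D p \<delta>\<gamma> = D_cost D p (\<delta>\<gamma>, 0)"

definition D_tau :: "path_problem \<Rightarrow> (real \<Rightarrow> real^2) \<times> real \<Rightarrow> real"
  where "D_tau D p = D_cost D p (0, 1)"

subsection \<open>Constraints and multipliers\<close>

definition U_ad :: "path_problem \<Rightarrow> (real \<Rightarrow> real^2) set"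
  where "U_ad D = {\<gamma> \<in> H1T (final_time D). \<forall>t\<in>{0..final_time D}. level_fun D (\<gamma> t) \<le> 0}"

definition G_con :: "path_problem \<Rightarrow> (real \<Rightarrow> real^2) \<Rightarrow> real \<Rightarrow> real"
  where "G_con D \<gamma> = (\<lambda>t. if t \<in> {0..final_time D} then level_fun D (\<gamma> t) else 0)"

definition DG_con :: "path_problem \<Rightarrow> (real \<Rightarrow> real^2) \<Rightarrow> (real \<Rightarrow> real^2) \<Rightarrow> real \<Rightarrow> real"
  where "DG_con D \<gamma> \<delta>\<gamma> = (\<lambda>t. frechet_derivative (level_fun D) (at (\<gamma> t)) (\<delta>\<gamma> t))"

definition K_cone :: "real \<Rightarrow> (real \<Rightarrow> real) set"
  where "K_cone T = {v \<in> H1T T. \<forall>t\<in>{0..T}. v t \<le> 0}"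

definition GG :: "path_problem \<Rightarrow> (real \<Rightarrow> real^2) \<times> real \<Rightarrow> (real \<Rightarrow> real) \<times> real"
  where "GG D = (\<lambda>(\<gamma>, \<tau>). (G_con D \<gamma>, \<tau>))"

definition DGG :: "path_problem \<Rightarrow> (real \<Rightarrow> real^2) \<times> real \<Rightarrow> (real \<Rightarrow> real^2) \<times> real \<Rightarrow>
    (real \<Rightarrow> real) \<times> real"
  where "DGG D p = (\<lambda>(\<delta>\<gamma>, \<delta>\<tau>). (DG_con D (fst p) \<delta>\<gamma>, \<delta>\<tau>))"

definition KK :: "path_problem \<Rightarrow> ((real \<Rightarrow> real) \<times> real) set"
  where "KK D = K_cone (final_time D) \<times> stop_times D"

definition annihilator :: "real \<Rightarrow> (((real \<Rightarrow> real) \<Rightarrow> real) \<times> real) \<Rightarrow> ((real \<Rightarrow> real) \<times> real) set"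
  where "annihilator T = (\<lambda>(l, \<mu>). {(z, \<sigma>) \<in> H1R T. l z + \<mu> * \<sigma> = 0})"

text \<open>\<open>\<mu> \<in> \<real>\<close> is identified with the functional \<open>s \<mapsto> \<mu> s\<close>.\<close>

definition lagrange_multiplier ::
    "path_problem \<Rightarrow> (real \<Rightarrow> real^2) \<times> real \<Rightarrow> ((real \<Rightarrow> real) \<Rightarrow> real) \<times> real \<Rightarrow> bool"
  where "lagrange_multiplier D p = (\<lambda>(l, \<mu>). let T = final_time D in
    l \<in> normal_cone (H1T T) (H1T_norm T) (K_cone T) (G_con D (fst p)) \<and>
    (\<lambda>s. \<mu> * s) \<in> normal_cone UNIV norm (stop_times D) (snd p) \<and>
    (\<forall>\<delta>\<gamma>\<in>H1T T. D_gamma D p \<delta>\<gamma> + l (DG_con D (fst p) \<delta>\<gamma>) = 0) \<and>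
    D_tau D p + \<mu> = 0)"

definition first_order_conditions :: "path_problem \<Rightarrow> (real \<Rightarrow> real^2) \<times> real \<Rightarrow> bool"
  where "first_order_conditions D p \<longleftrightarrow>
    (\<forall>\<delta>\<gamma>\<in>tangent_cone (H1T (final_time D)) (H1T_norm (final_time D)) (U_ad D) (fst p).
       0 \<le> D_gamma D p \<delta>\<gamma>) \<and>
    (\<forall>s\<in>stop_times D. 0 \<le> D_tau D p * (s - snd p))"

end

(*
  Put p = |grad g|^2 + g^2, which is positive by the regularity of g, and N = grad g / p. Every v in
  H^1(0,T) splits as v = g'(gamma)(v N(gamma)) + omega v with omega = g(gamma)^2 / p(gamma) <= k |g(gamma)|.
  For small eps > 0 both g(gamma) + eps omega v and g(gamma) - eps omega v lie in K. So omega v is in the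
  radial cone and every element of the normal cone annihilates it: this gives both Robinson conditions
  and shows that a multiplier is determined by l(v) = - D_gamma J (v N(gamma)).
  Conversely, this l is a multiplier, because every d with g(gamma) + t0 g'(gamma) d <= 0 for some t0 > 0
  is tangent to U_ad: the paths gamma + t d - C t^2 N(gamma) are feasible for small t. The correction only
  has to beat the second order Taylor remainder of g in the sup norm, so no H^1 estimate of it is needed.

  In one dimension H^1 consists of the primitives of L^2 functions. Product and chain rule follow without
  approximation arguments: the defect of the rule is additive over intervals and at most
  eps * (integral of an L^1 function) on short ones, hence zero.
*)
theory Submission
  imports Defs
begin

section \<open>Functions on an interval with a square integrable derivative\<close>

text \<open>Inside the admissible set the gradient of g may vanish, so g'(\<gamma>) has no right
  inverse in general; v |-> v N(\<gamma>) is one only up to the factor \<omega>. The defect is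
  harmless because \<omega> vanishes to second order in g: it is small precisely where the
  constraint is nearly active, and elsewhere the slack -g pays for it. The same absorption yields
  the multiplier equation: g'(\<gamma>) maps d - (g'(\<gamma>) d) N(\<gamma>) to \<omega>
  g'(\<gamma>) d, hence this direction and its negative are tangent, the derivative of the cost
  vanishes on it, and the cost sees d only through g'(\<gamma>) d. The stopping time is decoupled:
  the linearised constraint is the identity in that variable, so cone elements with time component 0
  suffice in both Robinson conditions. The spaces are given by weak derivatives, and the norm by an
  arbitrary choice among these. The work on the interval therefore identifies the carrier with
  primitives and shows that the norm does not depend on the choice; calculus is then available
  pointwise on the closed interval.\<close>

lemma L2_D: "f \<in> L2 M \<Longrightarrow> f \<in> borel_measurable M" "f \<in> L2 M \<Longrightarrow> integrable M (\<lambda>x. (norm (f x))\<^sup>2)"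
  by (auto simp: L2_def)

lemma L2_norm_le:
  assumes f: "f \<in> L2 M" and h: "h \<in> borel_measurable M"
    and le: "\<And>x. x \<in> space M \<Longrightarrow> norm (h x) \<le> C * norm (f x)"
  shows "h \<in> L2 M"
proof -
  have "integrable M (\<lambda>x. C\<^sup>2 * (norm (f x))\<^sup>2)"
    using L2_D(2)[OF f] by simp
  then have "integrable M (\<lambda>x. (norm (h x))\<^sup>2)"
  proof (rule Bochner_Integration.integrable_bound)
    show "(\<lambda>x. (norm (h x))\<^sup>2) \<in> borel_measurable M" using h by measurable
    show "AE x in M. norm ((norm (h x))\<^sup>2) \<le> norm (C\<^sup>2 * (norm (f x))\<^sup>2)"
    proof (rule AE_I2)
      fix x assume "x \<in> space M"
      then have "(norm (h x))\<^sup>2 \<le> (C * norm (f x))\<^sup>2"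
        by (intro power_mono le) auto
      then show "norm ((norm (h x))\<^sup>2) \<le> norm (C\<^sup>2 * (norm (f x))\<^sup>2)"
        by (simp add: power_mult_distrib abs_mult)
    qed
  qed
  with h show ?thesis by (simp add: L2_def)
qed

lemma norm_add_sq_le: "(norm (a + b))\<^sup>2 \<le> 2 * (norm a)\<^sup>2 + 2 * (norm (b::'a::real_normed_vector))\<^sup>2"
proof -
  have "(norm (a + b))\<^sup>2 \<le> (norm a + norm b)\<^sup>2"
    by (intro power_mono norm_triangle_ineq) auto
  also have "\<dots> \<le> 2 * (norm a)\<^sup>2 + 2 * (norm b)\<^sup>2"
    using sum_squares_ge_zero[of "norm a - norm b" 0] by (simp add: power2_eq_square algebra_simps)
  finally show ?thesis .
qed

lemma L2_add:
  assumes f: "f \<in> L2 M" and g: "g \<in> L2 M"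
  shows "(\<lambda>x. f x + g x) \<in> L2 M"
proof -
  have m: "(\<lambda>x. f x + g x) \<in> borel_measurable M" using L2_D(1)[OF f] L2_D(1)[OF g] by measurable
  have "integrable M (\<lambda>x. 2 * (norm (f x))\<^sup>2 + 2 * (norm (g x))\<^sup>2)"
    using L2_D(2)[OF f] L2_D(2)[OF g] by simp
  then have "integrable M (\<lambda>x. (norm (f x + g x))\<^sup>2)"
  proof (rule Bochner_Integration.integrable_bound)
    show "(\<lambda>x. (norm (f x + g x))\<^sup>2) \<in> borel_measurable M" using m by measurable
    show "AE x in M. norm ((norm (f x + g x))\<^sup>2) \<le> norm (2 * (norm (f x))\<^sup>2 + 2 * (norm (g x))\<^sup>2)"
      using norm_add_sq_le by (intro AE_I2) (simp add: order_trans[OF _ abs_ge_self])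
  qed
  with m show ?thesis by (simp add: L2_def)
qed

lemma L2_bounded_linear:
  assumes L: "bounded_linear L" and f: "f \<in> L2 M"
  shows "(\<lambda>x. L (f x)) \<in> L2 M"
proof -
  obtain K where "\<And>x. norm (L x) \<le> norm x * K" using bounded_linear.bounded[OF L] by blast
  moreover have "(\<lambda>x. L (f x)) \<in> borel_measurable M"
    using borel_measurable_continuous_on[OF linear_continuous_on[OF L] L2_D(1)[OF f]] by simp
  ultimately show ?thesis by (intro L2_norm_le[OF f, where C = K]) (auto simp: mult.commute)
qed

lemma finite_measure_Ioo: "finite_measure (lebesgue_on {a<..<b::real})"
  by (rule finite_measure_lebesgue_on) auto

lemma (in finite_measure) L2_integrable:
  assumes f: "f \<in> L2 M"
  shows "integrable M f"
proof -
  have "integrable M (\<lambda>x. 1 + (norm (f x))\<^sup>2)" using L2_D(2)[OF f] by simp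
  then show ?thesis
  proof (rule Bochner_Integration.integrable_bound)
    show "f \<in> borel_measurable M" by (rule L2_D[OF f])
    show "AE x in M. norm (f x) \<le> norm (1 + (norm (f x))\<^sup>2)"
    proof (rule AE_I2)
      fix x
      have "0 \<le> (norm (f x) - 1)\<^sup>2" by simp
      then have "2 * norm (f x) \<le> 1 + (norm (f x))\<^sup>2" unfolding power2_diff by simp
      then show "norm (f x) \<le> norm (1 + (norm (f x))\<^sup>2)"
        using norm_ge_zero[of "f x"] by (smt (verit) real_norm_def)
    qed
  qed
qed

section \<open>Lebesgue integrals over the open interval as gauge integrals over the closed
  one\<close>

lemma L2_Ioo_absolutely_integrable:
  assumes "w \<in> L2 (lebesgue_on {0<..<T::real})"
  shows "w absolutely_integrable_on {0..T}"
proof -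
  have "integrable (lebesgue_on {0<..<T}) w"
    by (rule finite_measure.L2_integrable[OF finite_measure_Ioo assms])
  then have "w absolutely_integrable_on {0<..<T}"
    unfolding set_integrable_def by (subst (asm) integrable_restrict_space) auto
  then show ?thesis by (simp add: absolutely_integrable_on_Icc_iff_Ioo)
qed

lemma LINT_Ioo_eq_integral:
  fixes w :: "real \<Rightarrow> 'b::euclidean_space"
  assumes "integrable (lebesgue_on {0<..<T}) w"
  shows "(LINT x|lebesgue_on {0<..<T}. w x) = integral {0..T} w"
  using lebesgue_integral_eq_integral[OF assms]
  by (simp add: integral_open_interval_real)

text \<open>Being a primitive is stated pointwise on the closed interval, endpoints included, so it
  carries the continuous representative with it and boundary terms make sense. The integral is the
  gauge integral; it exists because square integrable functions on an interval of finite length are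
  absolutely integrable.\<close>

definition has_L2_deriv ::
    "real \<Rightarrow> (real \<Rightarrow> 'b::euclidean_space) \<Rightarrow> (real \<Rightarrow> 'b) \<Rightarrow> bool"
  where "has_L2_deriv T u w \<longleftrightarrow> w \<in> L2 (lebesgue_on {0<..<T}) \<and>
    (\<forall>t\<in>{0..T}. u t = u 0 + integral {0..t} w)"

lemma has_L2_derivD:
  assumes "has_L2_deriv T u w"
  shows "w \<in> L2 (lebesgue_on {0<..<T})" "w absolutely_integrable_on {0..T}"
    "\<lbrakk>0 \<le> s; s \<le> t; t \<le> T\<rbrakk> \<Longrightarrow> w absolutely_integrable_on {s..t}"
    "\<lbrakk>0 \<le> s; s \<le> t; t \<le> T\<rbrakk> \<Longrightarrow> w integrable_on {s..t}"
    "\<lbrakk>0 \<le> s; s \<le> t; t \<le> T\<rbrakk> \<Longrightarrow> u t - u s = integral {s..t} w"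
    "continuous_on {0..T} u"
proof -
  have u: "u t = u 0 + integral {0..t} w" if "0 \<le> t" "t \<le> T" for t
    using assms that unfolding has_L2_deriv_def by (meson atLeastAtMost_iff)
  show w: "w \<in> L2 (lebesgue_on {0<..<T})" using assms by (simp add: has_L2_deriv_def)
  show a: "w absolutely_integrable_on {0..T}" by (rule L2_Ioo_absolutely_integrable[OF w])
  show b: "w absolutely_integrable_on {s..t}" if "0 \<le> s" "s \<le> t" "t \<le> T" for s t
    using that by (intro absolutely_integrable_on_subinterval[OF a]) auto
  show c: "w integrable_on {s..t}" if "0 \<le> s" "s \<le> t" "t \<le> T" for s t
    using b[OF that] by (simp add: absolutely_integrable_on_def)
  show "u t - u s = integral {s..t} w" if "0 \<le> s" "s \<le> t" "t \<le> T"
  proof -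
    have "u t = u 0 + integral {0..t} w" "u s = u 0 + integral {0..s} w"
      using that by (auto intro!: u simp del: add.right_neutral)
    moreover have "integral {0..s} w + integral {s..t} w = integral {0..t} w"
      using that by (intro Henstock_Kurzweil_Integration.integral_combine c) auto
    ultimately show ?thesis by (simp add: algebra_simps)
  qed
  show "continuous_on {0..T} u"
  proof -
    have "continuous_on {0..T} (\<lambda>t. u 0 + integral {0..t} w)"
      using a by (intro continuous_intros indefinite_integral_continuous_1)
        (simp add: absolutely_integrable_on_def)
    then show ?thesis
      by (rule continuous_on_eq) (metis atLeastAtMost_iff u)
  qed
qed

text \<open>Cut [0,t] into \<open>n\<close> equal pieces shorter than \<delta>: adding up the bounds
  gives |E 0 t| \<le> \<epsilon> times the integral of \<open>m\<close> over [0,t], and \<epsilon>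
  is arbitrary. In the product and chain rules \<open>E\<close> is the increment of a function minus
  the integral of its proposed derivative.\<close>

lemma additive_interval_function_eq_0:
  fixes E :: "real \<Rightarrow> real \<Rightarrow> 'b::real_normed_vector" and m :: "real \<Rightarrow> real"
  assumes add: "\<And>s t. \<lbrakk>0 \<le> s; s \<le> t; t \<le> T\<rbrakk> \<Longrightarrow> E 0 t = E 0 s + E s t"
    and m: "m integrable_on {0..T}"
    and small: "\<And>\<epsilon>. 0 < \<epsilon> \<Longrightarrow> \<exists>\<delta>>0. \<forall>s t. 0 \<le> s \<longrightarrow> s \<le> t \<longrightarrow> t \<le> T \<longrightarrow> t - s < \<delta> \<longrightarrow>
      norm (E s t) \<le> \<epsilon> * integral {s..t} m"
    and t: "0 \<le> t" "t \<le> T"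
  shows "E 0 t = 0"
proof -
  have mi: "m integrable_on {a..b}" if "0 \<le> a" "b \<le> T" for a b
    using that by (intro integrable_subinterval_real[OF m]) auto
  have bound: "norm (E 0 t) \<le> \<epsilon> * integral {0..t} m" if \<epsilon>: "0 < \<epsilon>" for \<epsilon>
  proof -
    obtain \<delta> where \<delta>: "\<delta> > 0" "\<And>s t. 0 \<le> s \<Longrightarrow> s \<le> t \<Longrightarrow> t \<le> T \<Longrightarrow> t - s < \<delta> \<Longrightarrow>
      norm (E s t) \<le> \<epsilon> * integral {s..t} m"
      using small[OF \<epsilon>] by blast
    obtain n :: nat where n: "t / \<delta> < real n" using reals_Archimedean2 by blast
    have n0: "0 < real n" using n t \<delta> by (meson divide_nonneg_pos order_le_less_trans)
    have tn: "t / real n < \<delta>" using n n0 \<delta> by (simp add: field_simps)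
    have "norm (E 0 (real k * t / real n)) \<le> \<epsilon> * integral {0..real k * t / real n} m" if "k \<le> n" for k
      using that
    proof (induction k)
      case 0
      have "E 0 0 = 0" using add[of 0 0] t by simp
      then show ?case by simp
    next
      case (Suc k)
      let ?a = "real k * t / real n" and ?b = "real (Suc k) * t / real n"
      have b: "?b \<le> t" using Suc.prems t n0
        by (simp add: divide_le_eq mult.commute mult_left_mono)
      have ab: "0 \<le> ?a" "?a \<le> ?b" "?b \<le> T" "?b - ?a < \<delta>"
        using t b tn n0 by (auto simp: divide_right_mono mult_right_mono diff_divide_distrib[symmetric] left_diff_distrib[symmetric])
      have "E 0 ?b = E 0 ?a + E ?a ?b" by (rule add) (use ab in auto)
      then have "norm (E 0 ?b) \<le> norm (E 0 ?a) + norm (E ?a ?b)" by (metis norm_triangle_ineq)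
      also have "\<dots> \<le> \<epsilon> * integral {0..?a} m + \<epsilon> * integral {?a..?b} m"
        using \<delta>(2)[OF ab] Suc by (intro add_mono) auto
      also have "\<dots> = \<epsilon> * integral {0..?b} m"
        using Henstock_Kurzweil_Integration.integral_combine[OF ab(1,2) mi[of 0 ?b]] ab
        by (simp add: algebra_simps flip: distrib_left)
      finally show ?case .
    qed
    from this[of n] show ?thesis using n0 by simp
  qed
  have "norm (E 0 t) \<le> 0"
  proof (rule ccontr)
    assume "\<not> norm (E 0 t) \<le> 0"
    then have pos: "0 < norm (E 0 t)" by simp
    let ?I = "integral {0..t} m"
    \<comment> \<open>With this \<epsilon> the bound is at most half of the norm; the summand 1
      keeps the denominator positive when the integral is 0.\<close>
    have "norm (E 0 t) \<le> norm (E 0 t) / (2 * (\<bar>?I\<bar> + 1)) * ?I"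
      by (rule bound) (use pos in simp)
    also have "\<dots> \<le> norm (E 0 t) / (2 * (\<bar>?I\<bar> + 1)) * (\<bar>?I\<bar> + 1)"
      by (intro mult_left_mono) auto
    also have "\<dots> = norm (E 0 t) / 2" by (simp add: field_simps)
    finally show False using pos by simp
  qed
  then show ?thesis by simp
qed

section \<open>Product rule for primitives\<close>

lemma continuous_on_Icc_measurable:
  fixes u :: "real \<Rightarrow> 'b::euclidean_space"
  assumes "continuous_on {0..T} u"
  shows "u \<in> borel_measurable (lebesgue_on {0<..<T})"
proof (rule continuous_imp_measurable_on_sets_lebesgue)
  show "continuous_on {0<..<T} u" by (rule continuous_on_subset[OF assms]) auto
  show "{0<..<T} \<in> sets lebesgue" by simp
qed

lemma L2_bilinear:
  fixes f :: "real \<Rightarrow> 'a::euclidean_space" and g :: "real \<Rightarrow> 'b::euclidean_space"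
    and mul :: "'a \<Rightarrow> 'b \<Rightarrow> 'c::euclidean_space"
  assumes b: "bounded_bilinear mul"
    and f: "continuous_on {0..T} f" and g: "g \<in> L2 (lebesgue_on {0<..<T})"
  shows "(\<lambda>t. mul (f t) (g t)) \<in> L2 (lebesgue_on {0<..<T})"
proof -
  interpret bounded_bilinear mul by (rule b)
  obtain K where K: "0 < K" "\<And>a b. norm (mul a b) \<le> norm a * norm b * K" using pos_bounded by blast
  have "bounded (f ` {0..T})" using f by (intro compact_imp_bounded compact_continuous_image) auto
  then obtain B where B: "0 < B" "\<And>t. t \<in> {0..T} \<Longrightarrow> norm (f t) \<le> B" unfolding bounded_pos by auto
  have "continuous_on UNIV (\<lambda>x. mul (fst x) (snd x))"
    by (intro continuous_on continuous_intros)
  from borel_measurable_continuous_Pair[OF continuous_on_Icc_measurable[OF f] L2_D(1)[OF g] this]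
  have m: "(\<lambda>t. mul (f t) (g t)) \<in> borel_measurable (lebesgue_on {0<..<T})" .
  show ?thesis
  proof (rule L2_norm_le[OF g m, where C = "B * K"])
    fix t assume "t \<in> space (lebesgue_on {0<..<T})"
    then have "norm (f t) * norm (g t) * K \<le> B * norm (g t) * K"
      using B K by (intro mult_right_mono) auto
    then show "norm (mul (f t) (g t)) \<le> B * K * norm (g t)"
      using K(2)[of "f t" "g t"] by (simp add: ac_simps)
  qed
qed

lemma uniformly_continuous_on_Icc:
  fixes u :: "real \<Rightarrow> 'b::euclidean_space"
  assumes "continuous_on {0..T} u" "0 < \<epsilon>"
  obtains \<delta> where "0 < \<delta>" "\<And>s t. \<lbrakk>s \<in> {0..T}; t \<in> {0..T}; \<bar>t - s\<bar> < \<delta>\<rbrakk> \<Longrightarrow> norm (u t - u s) < \<epsilon>"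
  using compact_uniformly_continuous[OF assms(1)] assms(2)
  unfolding uniformly_continuous_on_def by (auto simp: dist_norm)

lemma L2_finite_measure_bounded:
  assumes "finite_measure M" "f \<in> borel_measurable M" "\<And>x. x \<in> space M \<Longrightarrow> norm (f x) \<le> B"
  shows "f \<in> L2 M"
proof (rule L2_norm_le[of "\<lambda>_. 1::real"])
  interpret finite_measure M by fact
  show "(\<lambda>_. 1) \<in> L2 M" by (simp add: L2_def)
qed (use assms in auto)

text \<open>On [s,t] the first factor is frozen at the left end and the second at the right end,
  which makes the increment of the product exactly linear in the two increments. The integrand of
  the defect then contains only oscillations of \<open>u\<close> and \<open>v\<close>, uniformly
  small on short intervals, times \<open>z\<close> and \<open>w\<close>. A general bilinear map
  covers products of reals, scalar multiples and inner products at once.\<close>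

lemma has_L2_deriv_bilinear:
  fixes u :: "real \<Rightarrow> 'a::euclidean_space" and v :: "real \<Rightarrow> 'b::euclidean_space"
    and mul :: "'a \<Rightarrow> 'b \<Rightarrow> 'c::euclidean_space"
  assumes b: "bounded_bilinear mul"
    and u: "has_L2_deriv T u w" and v: "has_L2_deriv T v z"
  shows "has_L2_deriv T (\<lambda>t. mul (u t) (v t)) (\<lambda>t. mul (u t) (z t) + mul (w t) (v t))"
proof -
  interpret bounded_bilinear mul by (rule b)
  obtain K where K: "0 < K" "\<And>a b. norm (mul a b) \<le> norm a * norm b * K" using pos_bounded by blast
  let ?h = "\<lambda>t. mul (u t) (z t) + mul (w t) (v t)"
  note cu = has_L2_derivD(6)[OF u] and cv = has_L2_derivD(6)[OF v]
  have h: "?h \<in> L2 (lebesgue_on {0<..<T})"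
    by (intro L2_add L2_bilinear[OF b] L2_bilinear[OF flip] cu cv has_L2_derivD(1)[OF u]
        has_L2_derivD(1)[OF v])
  have hi: "?h absolutely_integrable_on {0..T}" by (rule L2_Ioo_absolutely_integrable[OF h])
  have hi': "?h integrable_on {s..t}" if "0 \<le> s" "t \<le> T" for s t
    using that absolutely_integrable_on_subinterval[OF hi, of s t]
    by (auto simp: absolutely_integrable_on_def)
  define m where "m t = norm (z t) + norm (w t)" for t
  have mi: "m integrable_on {s..t}" if "0 \<le> s" "s \<le> t" "t \<le> T" for s t
    unfolding m_def using has_L2_derivD(3)[OF u that] has_L2_derivD(3)[OF v that]
    by (intro integrable_add) (auto simp: absolutely_integrable_on_def)
  define E where "E s t = mul (u t) (v t) - mul (u s) (v s) - integral {s..t} ?h" for s t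
  have E0: "E 0 t = 0" if t: "0 \<le> t" "t \<le> T" for t
  proof (rule additive_interval_function_eq_0[where E = E and m = m and T = T])
    show "E 0 t = E 0 s + E s t" if "0 \<le> s" "s \<le> t" "t \<le> T" for s t
      using Henstock_Kurzweil_Integration.integral_combine[OF that(1,2) hi'[of 0 t]] that
      by (simp add: E_def algebra_simps)
    show "m integrable_on {0..T}" using mi[of 0 T] t by auto
    fix \<epsilon> :: real assume \<epsilon>: "0 < \<epsilon>"
    \<comment> \<open>The bound K of the bilinear map multiplies both oscillations, hence the
      tolerance \<epsilon> / K.\<close>
    then have eK: "0 < \<epsilon> / K" using K by simp
    obtain \<delta>1 where \<delta>1: "0 < \<delta>1" "\<And>s t. \<lbrakk>s \<in> {0..T}; t \<in> {0..T}; \<bar>t - s\<bar> < \<delta>1\<rbrakk> \<Longrightarrow> norm (u t - u s) < \<epsilon> / K"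
      using uniformly_continuous_on_Icc[OF cu eK] by blast
    obtain \<delta>2 where \<delta>2: "0 < \<delta>2" "\<And>s t. \<lbrakk>s \<in> {0..T}; t \<in> {0..T}; \<bar>t - s\<bar> < \<delta>2\<rbrakk> \<Longrightarrow> norm (v t - v s) < \<epsilon> / K"
      using uniformly_continuous_on_Icc[OF cv eK] by blast
    show "\<exists>\<delta>>0. \<forall>s t. 0 \<le> s \<longrightarrow> s \<le> t \<longrightarrow> t \<le> T \<longrightarrow> t - s < \<delta> \<longrightarrow> norm (E s t) \<le> \<epsilon> * integral {s..t} m"
    proof (intro exI[of _ "min \<delta>1 \<delta>2"] conjI allI impI)
      fix s t assume st: "0 \<le> s" "s \<le> t" "t \<le> T" "t - s < min \<delta>1 \<delta>2"
      note iz = has_L2_derivD(4)[OF v st(1-3)] and iw = has_L2_derivD(4)[OF u st(1-3)]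
      have i1: "(\<lambda>x. mul (u s) (z x)) integrable_on {s..t}"
        using integrable_linear[OF iz bounded_linear_right] by (simp add: o_def)
      have i2: "(\<lambda>x. mul (w x) (v t)) integrable_on {s..t}"
        using integrable_linear[OF iw bounded_linear_left] by (simp add: o_def)
      have i12: "(\<lambda>x. mul (u s) (z x) + mul (w x) (v t)) integrable_on {s..t}"
        by (intro integrable_add i1 i2)
      have "mul (u t) (v t) - mul (u s) (v s) = mul (u s) (v t - v s) + mul (u t - u s) (v t)"
        by (simp add: diff_left diff_right)
      also have "\<dots> = integral {s..t} (\<lambda>x. mul (u s) (z x) + mul (w x) (v t))"
        using integral_linear[OF iz bounded_linear_right, of "u s"]
          integral_linear[OF iw bounded_linear_left, of "v t"]
          has_L2_derivD(5)[OF u st(1-3)] has_L2_derivD(5)[OF v st(1-3)]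
          Henstock_Kurzweil_Integration.integral_add[OF i1 i2]
        by (simp add: o_def)
      finally have "E s t = integral {s..t} (\<lambda>x. mul (u s) (z x) + mul (w x) (v t) - ?h x)"
        unfolding E_def using Henstock_Kurzweil_Integration.integral_diff[OF i12 hi'[of s t]] st by simp
      moreover have "norm (integral {s..t} (\<lambda>x. mul (u s) (z x) + mul (w x) (v t) - ?h x))
          \<le> integral {s..t} (\<lambda>x. \<epsilon> * m x)"
      proof (rule Henstock_Kurzweil_Integration.integral_norm_bound_integral)
        show "(\<lambda>x. mul (u s) (z x) + mul (w x) (v t) - ?h x) integrable_on {s..t}"
          using st by (intro integrable_diff i12 hi') auto
        show "(\<lambda>x. \<epsilon> * m x) integrable_on {s..t}"
          by (intro integrable_on_mult_right mi st(1-3))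
        fix x assume x: "x \<in> {s..t}"
        have a: "norm (u s - u x) \<le> \<epsilon> / K" "norm (v t - v x) \<le> \<epsilon> / K"
          using x st \<delta>1(2)[of x s] \<delta>2(2)[of x t] by auto
        have "mul (u s) (z x) + mul (w x) (v t) - ?h x = mul (u s - u x) (z x) + mul (w x) (v t - v x)"
          by (simp add: diff_left diff_right)
        also have "norm \<dots> \<le> norm (u s - u x) * norm (z x) * K + norm (w x) * norm (v t - v x) * K"
          by (intro order_trans[OF norm_triangle_ineq] add_mono K)
        also have "\<dots> \<le> (\<epsilon> / K) * norm (z x) * K + norm (w x) * (\<epsilon> / K) * K"
          using K(1) a by (intro add_mono mult_right_mono mult_left_mono) auto
        also have "\<dots> = \<epsilon> * m x" using K(1) by (simp add: m_def field_simps)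
        finally show "norm (mul (u s) (z x) + mul (w x) (v t) - ?h x) \<le> \<epsilon> * m x" .
      qed
      ultimately show "norm (E s t) \<le> \<epsilon> * integral {s..t} m" by simp
    qed (use \<delta>1 \<delta>2 in auto)
  qed (use t in auto)
  show ?thesis unfolding has_L2_deriv_def
  proof (intro conjI ballI h)
    fix t assume "t \<in> {0..T}"
    then have "E 0 t = 0" by (intro E0) auto
    then show "mul (u t) (v t) = mul (u 0) (v 0) + integral {0..t} ?h" by (simp add: E_def algebra_simps)
  qed
qed

section \<open>Weak derivatives on an interval\<close>

lemma C_class_1_iff:
  "C_class 1 f \<longleftrightarrow> (\<forall>x. f differentiable (at x)) \<and>
    (\<forall>v. continuous_on UNIV (\<lambda>x. frechet_derivative f (at x) v))"
  by (simp add: One_nat_def)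

lemma C_class_1_real:
  fixes f :: "real \<Rightarrow> real"
  assumes f: "\<And>x. (f has_real_derivative f' x) (at x)" and c: "continuous_on UNIV f'"
  shows "C_class 1 f" "frechet_derivative f (at x) v = f' x * v"
proof -
  have *: "frechet_derivative f (at x) = (\<lambda>v. f' x * v)" for x
    using frechet_derivative_at[of f "(*) (f' x)" x] f[of x] by (simp add: has_field_derivative_def)
  then show "frechet_derivative f (at x) v = f' x * v" by simp
  have "f differentiable at x" for x
    using f[of x] by (auto simp: has_field_derivative_def differentiable_def)
  then show "C_class 1 f"
    unfolding C_class_1_iff * using c by (auto intro!: continuous_intros)
qed

text \<open>Puts test functions under the same calculus as H^1 functions, so that integration by
  parts becomes an instance of the product rule.\<close>

lemma has_L2_deriv_C1:
  fixes \<phi> :: "real \<Rightarrow> real"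
  assumes "C_class 1 \<phi>"
  shows "has_L2_deriv T \<phi> (\<lambda>t. frechet_derivative \<phi> (at t) 1)"
proof -
  let ?d = "\<lambda>t. frechet_derivative \<phi> (at t) 1"
  have c: "continuous_on S ?d" for S
    using assms continuous_on_subset[of UNIV ?d S] by (auto simp: C_class_1_iff)
  have d: "(\<phi> has_vector_derivative ?d t) (at t within S)" for t S
  proof -
    have D: "(\<phi> has_derivative frechet_derivative \<phi> (at t)) (at t)"
      using assms unfolding C_class_1_iff frechet_derivative_works by blast
    have "frechet_derivative \<phi> (at t) x = x *\<^sub>R ?d t" for x
      using linear_scale[OF has_derivative_linear[OF D], of x 1] by simp
    then have "frechet_derivative \<phi> (at t) = (\<lambda>x. x *\<^sub>R ?d t)" by (rule ext)
    then show ?thesis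
      using has_derivative_at_withinI[OF D] unfolding has_vector_derivative_def by metis
  qed
  show ?thesis unfolding has_L2_deriv_def
  proof (intro conjI ballI)
    have "bounded (?d ` {0..T})" by (intro compact_imp_bounded compact_continuous_image c) auto
    then obtain B where B: "\<And>t. t \<in> {0..T} \<Longrightarrow> norm (?d t) \<le> B" unfolding bounded_iff by blast
    show "?d \<in> L2 (lebesgue_on {0<..<T})"
      by (rule L2_finite_measure_bounded[OF finite_measure_Ioo continuous_on_Icc_measurable[OF c], where B = B])
        (use B in auto)
    fix t assume "t \<in> {0..T}"
    then have "(?d has_integral \<phi> t - \<phi> 0) {0..t}"
      by (intro fundamental_theorem_of_calculus d) auto
    then show "\<phi> t = \<phi> 0 + integral {0..t} ?d" by (simp add: integral_unique)
  qed
qed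

lemma test_function_Ioo_endpoints:
  assumes "\<phi> \<in> test_functions {0<..<T::real}"
  shows "\<phi> 0 = 0" "\<phi> T = 0"
proof -
  have "{x. \<phi> x \<noteq> 0} \<subseteq> {0<..<T}"
    using assms closure_subset[of "{x. \<phi> x \<noteq> 0}"] unfolding test_functions_def by blast
  then show "\<phi> 0 = 0" "\<phi> T = 0" by auto
qed

text \<open>This is the product rule for \<phi> u integrated over [0,T]; the boundary terms vanish
  since the support of \<phi> lies inside the open interval.\<close>

lemma has_L2_deriv_imp_has_weak_deriv:
  fixes u :: "real \<Rightarrow> 'b::euclidean_space"
  assumes T: "0 < T" and u: "has_L2_deriv T u w"
  shows "has_weak_deriv {0<..<T} 1 u w"
  unfolding has_weak_deriv_def
proof
  fix \<phi> :: "real \<Rightarrow> real" assume \<phi>: "\<phi> \<in> test_functions {0<..<T}"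
  then have "C_class 1 \<phi>" by (simp add: test_functions_def)
  from has_L2_deriv_C1[OF this] have d: "has_L2_deriv T \<phi> (\<lambda>t. frechet_derivative \<phi> (at t) 1)" (is "has_L2_deriv T \<phi> ?d") .
  let ?M = "lebesgue_on {0<..<T}"
  have i1: "integrable ?M (\<lambda>t. \<phi> t *\<^sub>R w t)"
    by (intro finite_measure.L2_integrable[OF finite_measure_Ioo] L2_bilinear[OF bounded_bilinear_scaleR]
        has_L2_derivD(6)[OF d] has_L2_derivD(1)[OF u])
  have i2: "integrable ?M (\<lambda>t. ?d t *\<^sub>R u t)"
    by (intro finite_measure.L2_integrable[OF finite_measure_Ioo]
        L2_bilinear[OF bounded_bilinear.flip[OF bounded_bilinear_scaleR]]
        has_L2_derivD(6)[OF u] has_L2_derivD(1)[OF d])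
  have "\<phi> T *\<^sub>R u T - \<phi> 0 *\<^sub>R u 0 = integral {0..T} (\<lambda>t. \<phi> t *\<^sub>R w t + ?d t *\<^sub>R u t)"
    by (rule has_L2_derivD(5)[OF has_L2_deriv_bilinear[OF bounded_bilinear_scaleR d u]]) (use T in auto)
  also have "\<dots> = (LINT t|?M. \<phi> t *\<^sub>R w t + ?d t *\<^sub>R u t)"
    by (rule LINT_Ioo_eq_integral[symmetric]) (intro Bochner_Integration.integrable_add i1 i2)
  also have "\<dots> = (LINT t|?M. \<phi> t *\<^sub>R w t) + (LINT t|?M. ?d t *\<^sub>R u t)"
    by (rule Bochner_Integration.integral_add[OF i1 i2])
  finally show "(LINT t|?M. ?d t *\<^sub>R u t) = - (LINT t|?M. \<phi> t *\<^sub>R w t)"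
    using test_function_Ioo_endpoints[OF \<phi>] by (simp add: eq_neg_iff_add_eq_0 add.commute)
qed

text \<open>The hat function is supported in \<open>[0,1]\<close> and has integral \<open>1\<close>; the step is its primitive.\<close>

definition hat :: "real \<Rightarrow> real"
  where "hat x = 4 * max 0 x - 8 * max 0 (x - 1/2) + 4 * max 0 (x - 1)"

definition smooth_step :: "real \<Rightarrow> real"
  where "smooth_step x = 2 * (max 0 x)\<^sup>2 - 4 * (max 0 (x - 1/2))\<^sup>2 + 2 * (max 0 (x - 1))\<^sup>2"

section \<open>Weak derivatives are derivatives of primitives: testing with approximate
  indicators\<close>

lemma hat_nonneg: "0 \<le> hat x" and hat_eq_0: "x \<le> 0 \<or> 1 \<le> x \<Longrightarrow> hat x = 0"
  by (auto simp: hat_def max_def)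

lemma continuous_on_hat: "continuous_on S hat"
  unfolding hat_def by (intro continuous_intros)

text \<open>Squaring removes the kink of the positive part: at 0 the difference quotient is bounded
  by |h|. Combinations of such squares are therefore C^1, the smoothness demanded of test
  functions.\<close>

lemma DERIV_max_0_sq: "((\<lambda>x. (max 0 x)\<^sup>2) has_real_derivative 2 * max 0 x) (at (x::real))"
proof (cases x "0::real" rule: linorder_cases)
  case less
  have "((\<lambda>x. 0) has_real_derivative 2 * max 0 x) (at x)" using less by (simp add: max_def)
  then show ?thesis
    by (rule has_field_derivative_transform_within_open[where S = "{..<0}"]) (use less in \<open>auto simp: max_def\<close>)
next
  case greater
  have "((\<lambda>x. x\<^sup>2) has_real_derivative 2 * max 0 x) (at x)" using greater
    by (auto simp: max_def intro!: derivative_eq_intros)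
  then show ?thesis
    by (rule has_field_derivative_transform_within_open[where S = "{0<..}"]) (use greater in \<open>auto simp: max_def\<close>)
next
  case equal
  have "((\<lambda>h. (max 0 h)\<^sup>2 / h) \<longlongrightarrow> 0) (at (0::real))"
  proof (rule Lim_null_comparison)
    show "\<forall>\<^sub>F h in at 0. norm ((max 0 h)\<^sup>2 / h) \<le> \<bar>h::real\<bar>"
      by (auto simp: max_def power2_eq_square)
    show "((\<lambda>h. \<bar>h\<bar>) \<longlongrightarrow> 0) (at (0::real))" by (intro tendsto_rabs_zero tendsto_ident_at)
  qed
  then show ?thesis unfolding equal by (simp add: DERIV_def)
qed

lemma DERIV_smooth_step: "(smooth_step has_real_derivative hat x) (at x)"
proof -
  have "((\<lambda>y. (max 0 (y - c))\<^sup>2) has_real_derivative 2 * max 0 (x - c)) (at x)" for c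
    using DERIV_shift[of "\<lambda>x. (max 0 x)\<^sup>2" "2 * max 0 (x - c)" x "- c"] DERIV_max_0_sq[of "x - c"] by simp
  note d = this[of "1/2"] this[of 1] DERIV_max_0_sq[of x]
  show ?thesis unfolding smooth_step_def[abs_def]
    using DERIV_add[OF DERIV_diff[OF DERIV_cmult[OF d(3), of 2] DERIV_cmult[OF d(1), of 4]] DERIV_cmult[OF d(2), of 2]]
    by (simp add: hat_def)
qed

lemma smooth_step_le_0: "x \<le> 0 \<Longrightarrow> smooth_step x = 0"
  and smooth_step_ge_1: "1 \<le> x \<Longrightarrow> smooth_step x = 1"
  by (auto simp: smooth_step_def max_def power2_eq_square field_simps)

lemma smooth_step_bounds: "0 \<le> smooth_step x" "smooth_step x \<le> 1"
proof -
  have mono: "smooth_step x \<le> smooth_step y" if "x \<le> y" for x y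
    by (rule DERIV_nonneg_imp_nondecreasing[OF that]) (use DERIV_smooth_step hat_nonneg in blast)
  show "0 \<le> smooth_step x" using mono[of 0 x] smooth_step_le_0[of x] smooth_step_le_0[of 0] by fastforce
  show "smooth_step x \<le> 1" using mono[of x 1] smooth_step_ge_1[of x] smooth_step_ge_1[of 1] by fastforce
qed

text \<open>For x = 0 the sequence is constantly 0, so the limit is the indicator of the open
  half-line. Differences of steps shifted to \<open>a\<close> and \<open>b\<close> thus converge to
  the indicator of the interval that excludes \<open>a\<close> and includes
  \<open>b\<close>.\<close>

lemma smooth_step_tendsto:
  "(\<lambda>n. smooth_step (real n * x)) \<longlonglongrightarrow> (if 0 < x then 1 else 0)"
proof (cases "0 < x")
  case True
  then obtain N :: nat where N: "1 / x < real N" using reals_Archimedean2 by blast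
  have "smooth_step (real n * x) = 1" if "N \<le> n" for n
  proof (rule smooth_step_ge_1)
    have "1 \<le> real N * x" using N True by (simp add: field_simps)
    also have "\<dots> \<le> real n * x" using that True by (intro mult_right_mono) auto
    finally show "1 \<le> real n * x" .
  qed
  then show ?thesis using True
    by (intro tendsto_eventually) (auto simp: eventually_sequentially)
next
  case False
  then have "smooth_step (real n * x) = 0" for n
    by (intro smooth_step_le_0) (simp add: mult_nonneg_nonpos)
  then show ?thesis using False by simp
qed

lemma DERIV_scaled_step:
  "((\<lambda>t. smooth_step (n * (t - a))) has_real_derivative n * hat (n * (t - a))) (at t)"
proof -
  have "((\<lambda>t. n * (t - a)) has_real_derivative n) (at t)"
    by (auto intro!: derivative_eq_intros)
  from DERIV_chain2[OF DERIV_smooth_step this] show ?thesis by (simp add: mult.commute)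
qed

text \<open>The kernels have mass 1 and are one-sided, supported in [a, a + 1/n]; hence a = 0 is
  allowed, while a < T leaves room on the right. Uniform continuity makes \<open>u\<close> almost
  constant on the support.\<close>

lemma hat_approximates_delta:
  fixes u :: "real \<Rightarrow> 'b::euclidean_space"
  assumes u: "continuous_on {0..T} u" and a: "0 \<le> a" "a < T"
  shows "(\<lambda>n. integral {0..T} (\<lambda>t. (real n * hat (real n * (t - a))) *\<^sub>R u t)) \<longlonglongrightarrow> u a"
proof (rule LIMSEQ_I)
  fix \<epsilon> :: real assume "0 < \<epsilon>"
  then have "0 < \<epsilon> / 2" by simp
  from uniformly_continuous_on_Icc[OF u this] obtain \<delta> where
    \<delta>: "0 < \<delta>" "\<And>s t. \<lbrakk>s \<in> {0..T}; t \<in> {0..T}; \<bar>t - s\<bar> < \<delta>\<rbrakk> \<Longrightarrow> norm (u t - u s) < \<epsilon> / 2"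
    by blast
  \<comment> \<open>\<open>N\<close> is so large that the support length 1/n is below both \<delta>
    and T - a.\<close>
  obtain N :: nat where N: "1 / min \<delta> (T - a) < real N" using reals_Archimedean2 by blast
  have m: "0 < min \<delta> (T - a)" using \<delta> a by simp
  show "\<exists>N. \<forall>n\<ge>N. norm (integral {0..T} (\<lambda>t. (real n * hat (real n * (t - a))) *\<^sub>R u t) - u a) < \<epsilon>"
  proof (intro exI[of _ N] allI impI)
    fix n assume n: "N \<le> n"
    have nm: "1 < real n * min \<delta> (T - a)"
    proof -
      have "1 < real N * min \<delta> (T - a)" using N m by (simp add: field_simps)
      also have "\<dots> \<le> real n * min \<delta> (T - a)" using n m by (intro mult_right_mono) auto
      finally show ?thesis .
    qed
    have n0: "0 < real n" using nm m by (cases "n = 0") auto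
    let ?k = "\<lambda>t. real n * hat (real n * (t - a))"
    have ck: "continuous_on {0..T} ?k"
      by (intro continuous_intros continuous_on_compose2[OF continuous_on_hat[of UNIV]]) auto
    \<comment> \<open>The mass is read off from the primitive: the step has reached 1 at T and is
      still 0 at the left end.\<close>
    have "(?k has_integral smooth_step (real n * (T - a)) - smooth_step (real n * (0 - a))) {0..T}"
      using a DERIV_scaled_step[THEN has_field_derivative_at_within]
      by (intro fundamental_theorem_of_calculus)
         (auto simp: has_real_derivative_iff_has_vector_derivative[symmetric])
    moreover have "smooth_step (real n * (T - a)) = 1"
      using nm n0 a by (intro smooth_step_ge_1) (smt (verit) mult_left_mono)
    moreover have "smooth_step (real n * (0 - a)) = 0"
      using n0 a by (intro smooth_step_le_0) (simp add: mult_nonneg_nonpos)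
    ultimately have k1: "(?k has_integral 1) {0..T}" by simp
    have i1: "(\<lambda>t. ?k t *\<^sub>R u t) integrable_on {0..T}"
      by (intro integrable_continuous_real continuous_intros ck u)
    have k2: "((\<lambda>t. ?k t *\<^sub>R u a) has_integral u a) {0..T}"
      using has_integral_scaleR_left[OF k1, of "u a"] by simp
    have "integral {0..T} (\<lambda>t. ?k t *\<^sub>R u t) - u a = integral {0..T} (\<lambda>t. ?k t *\<^sub>R u t - ?k t *\<^sub>R u a)"
      using Henstock_Kurzweil_Integration.integral_diff[OF i1 has_integral_integrable[OF k2]] integral_unique[OF k2] by simp
    also have "norm \<dots> \<le> integral {0..T} (\<lambda>t. \<epsilon> / 2 * ?k t)"
    proof (rule Henstock_Kurzweil_Integration.integral_norm_bound_integral)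
      show "(\<lambda>t. ?k t *\<^sub>R u t - ?k t *\<^sub>R u a) integrable_on {0..T}"
        by (intro integrable_diff i1 has_integral_integrable[OF k2])
      show "(\<lambda>t. \<epsilon> / 2 * ?k t) integrable_on {0..T}"
        by (intro integrable_on_mult_right has_integral_integrable[OF k1])
      fix t assume t: "t \<in> {0..T}"
      show "norm (?k t *\<^sub>R u t - ?k t *\<^sub>R u a) \<le> \<epsilon> / 2 * ?k t"
      proof (cases "?k t = 0")
        case False
        then have "hat (real n * (t - a)) \<noteq> 0" by simp
        then have *: "0 < real n * (t - a)" "real n * (t - a) < 1" using hat_eq_0 by (meson not_le)+
        then have "0 < t - a" using n0 by (simp add: zero_less_mult_iff)
        moreover have "t - a < \<delta>"
        proof (rule ccontr)
          assume "\<not> t - a < \<delta>"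
          then have "real n * min \<delta> (T - a) \<le> real n * (t - a)" using n0 by (intro mult_left_mono) auto
          then show False using nm * by simp
        qed
        ultimately have "norm (u t - u a) < \<epsilon> / 2" using \<delta>(2)[of a t] t a by auto
        moreover have "norm (?k t *\<^sub>R u t - ?k t *\<^sub>R u a) = ?k t * norm (u t - u a)"
          using hat_nonneg[of "real n * (t - a)"] by (simp flip: scaleR_diff_right)
        ultimately show ?thesis
          using hat_nonneg[of "real n * (t - a)"] mult_left_mono[of "norm (u t - u a)" "\<epsilon> / 2" "?k t"] by (simp add: mult.commute)
      next
        case True
        then show ?thesis by (simp only:) simp
      qed
    qed
    also have "\<dots> = \<epsilon> / 2" using integral_unique[OF k1] by simp
    finally show "norm (integral {0..T} (\<lambda>t. ?k t *\<^sub>R u t) - u a) < \<epsilon>" using \<open>0 < \<epsilon>\<close> by linarith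
  qed
qed

text \<open>The bump rises on [a, a + 1/n] and falls on [b, b + 1/n], hence the condition b + 1/n <
  T. Its derivative is the difference of the two kernels that recover u(a) and u(b).\<close>

lemma smooth_bump_test_function:
  assumes ab: "0 < a" "a < b" "b + 1 / real n < T" and n: "0 < n"
  shows "(\<lambda>t. smooth_step (real n * (t - a)) - smooth_step (real n * (t - b))) \<in> test_functions {0<..<T}"
    (is "?\<phi> \<in> _")
    and "frechet_derivative (\<lambda>t. smooth_step (real n * (t - a)) - smooth_step (real n * (t - b))) (at t) 1
      = real n * hat (real n * (t - a)) - real n * hat (real n * (t - b))"
proof -
  have d: "(?\<phi> has_real_derivative real n * hat (real n * (t - a)) - real n * hat (real n * (t - b))) (at t)" for t
    by (intro DERIV_diff DERIV_scaled_step)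
  have c: "continuous_on UNIV (\<lambda>t. real n * hat (real n * (t - a)) - real n * hat (real n * (t - b)))"
    by (intro continuous_intros continuous_on_compose2[OF continuous_on_hat[of UNIV]]) auto
  show "frechet_derivative ?\<phi> (at t) 1 = real n * hat (real n * (t - a)) - real n * hat (real n * (t - b))"
    using C_class_1_real(2)[OF d c, of t 1] by simp
  have "?\<phi> t = 0" if "t \<notin> {a..b + 1 / real n}" for t
  proof (cases "t < a")
    case True
    then show ?thesis using n ab by (simp add: smooth_step_le_0 mult_nonneg_nonpos)
  next
    case False
    then have "b + 1 / real n < t" using that by auto
    then have "1 \<le> real n * (t - b)" using n by (simp add: field_simps)
    moreover have "real n * (t - b) \<le> real n * (t - a)" using n ab by (intro mult_left_mono) auto
    ultimately show ?thesis using smooth_step_ge_1 by simp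
  qed
  then have "{t. ?\<phi> t \<noteq> 0} \<subseteq> {a..b + 1 / real n}" by blast
  then have "closure {t. ?\<phi> t \<noteq> 0} \<subseteq> {a..b + 1 / real n}" by (simp add: closure_minimal)
  moreover from this have "compact (closure {t. ?\<phi> t \<noteq> 0})"
    by (meson bounded_closed_interval bounded_subset closed_closure compact_eq_bounded_closed)
  ultimately show "?\<phi> \<in> test_functions {0<..<T}"
    using C_class_1_real(1)[OF d c] ab by (auto simp: test_functions_def)
qed

text \<open>Test with the bumps: the side with their derivative tends to u(a) - u(b) because the
  kernels concentrate at \<open>a\<close> and \<open>b\<close>; on the other side dominated
  convergence, with majorant |w|, produces the integral of \<open>w\<close>.\<close>

lemma weak_deriv_interval:
  fixes u :: "real \<Rightarrow> 'b::euclidean_space"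
  assumes u: "continuous_on {0..T} u" and w: "w \<in> L2 (lebesgue_on {0<..<T})"
    and weak: "has_weak_deriv {0<..<T} 1 u w" and ab: "0 < a" "a < b" "b < T"
  shows "u b - u a = integral {a..b} w"
proof -
  let ?M = "lebesgue_on {0<..<T}"
  let ?\<phi> = "\<lambda>n t. smooth_step (real n * (t - a)) - smooth_step (real n * (t - b))"
  let ?k = "\<lambda>n c t. real n * hat (real n * (t - c))"
  have wi: "integrable ?M w" by (rule finite_measure.L2_integrable[OF finite_measure_Ioo w])
  have cs: "continuous_on UNIV smooth_step"
    using DERIV_smooth_step by (auto intro!: DERIV_continuous_on)
  have "(\<lambda>n. LINT t|?M. ?\<phi> n t *\<^sub>R w t) \<longlonglongrightarrow> (LINT t|?M. indicat_real {a<..b} t *\<^sub>R w t)"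
  proof (rule integral_dominated_convergence[where w = "\<lambda>t. norm (w t)"])
    show "(\<lambda>t. indicat_real {a<..b} t *\<^sub>R w t) \<in> borel_measurable ?M"
    proof (rule borel_measurable_scaleR)
      show "indicat_real {a<..b} \<in> borel_measurable ?M"
        by (intro measurable_restrict_space1 borel_measurable_indicator) simp
      show "w \<in> borel_measurable ?M" using wi by measurable
    qed
    show "integrable ?M (\<lambda>t. norm (w t))" using wi by simp
    show "(\<lambda>t. ?\<phi> n t *\<^sub>R w t) \<in> borel_measurable ?M" for n
    proof (rule borel_measurable_scaleR)
      show "?\<phi> n \<in> borel_measurable ?M"
        by (intro continuous_on_Icc_measurable continuous_intros continuous_on_compose2[OF cs]) auto
      show "w \<in> borel_measurable ?M" using wi by measurable
    qed
    show "AE t in ?M. (\<lambda>n. ?\<phi> n t *\<^sub>R w t) \<longlonglongrightarrow> indicat_real {a<..b} t *\<^sub>R w t"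
    proof (rule AE_I2, rule tendsto_scaleR)
      fix t
      have "(\<lambda>n. ?\<phi> n t) \<longlonglongrightarrow> (if 0 < t - a then 1 else 0) - (if 0 < t - b then 1 else 0)"
        by (intro tendsto_diff smooth_step_tendsto)
      then show "(\<lambda>n. ?\<phi> n t) \<longlonglongrightarrow> indicat_real {a<..b} t"
        by (rule back_subst[of "\<lambda>x. _ \<longlonglongrightarrow> x"]) (use ab in \<open>auto simp: indicator_def\<close>)
    qed simp
    show "AE t in ?M. norm (?\<phi> n t *\<^sub>R w t) \<le> norm (w t)" for n
    proof (rule AE_I2)
      fix t
      have "\<bar>?\<phi> n t\<bar> \<le> 1"
        using smooth_step_bounds[of "real n * (t - a)"] smooth_step_bounds[of "real n * (t - b)"] by auto
      then show "norm (?\<phi> n t *\<^sub>R w t) \<le> norm (w t)" by (simp add: mult_left_le_one_le)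
    qed
  qed
  moreover have "(LINT t|?M. indicat_real {a<..b} t *\<^sub>R w t) = integral {a..b} w"
  proof -
    have "integrable ?M (\<lambda>t. indicat_real {a<..b} t *\<^sub>R w t)"
      using ab by (intro integrable_mult_indicator wi) (auto simp: sets_restrict_space_iff)
    then have "(LINT t|?M. indicat_real {a<..b} t *\<^sub>R w t) = integral {0..T} (\<lambda>t. indicat_real {a<..b} t *\<^sub>R w t)"
      by (rule LINT_Ioo_eq_integral)
    \<comment> \<open>The limit indicator and that of the closed interval differ only at the point
      \<open>a\<close>.\<close>
    also have "\<dots> = integral {0..T} (\<lambda>t. if t \<in> {a..b} then w t else 0)"
      by (rule integral_spike[where S = "{a}"]) (auto simp: indicator_def)
    also have "\<dots> = integral {a..b} w"
      using ab by (subst integral_restrict_Int) (simp add: Int_absorb1)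
    finally show ?thesis .
  qed
  ultimately have 1: "(\<lambda>n. LINT t|?M. ?\<phi> n t *\<^sub>R w t) \<longlonglongrightarrow> integral {a..b} w" by simp
  have 2: "(\<lambda>n. integral {0..T} (\<lambda>t. ?k n a t *\<^sub>R u t) - integral {0..T} (\<lambda>t. ?k n b t *\<^sub>R u t)) \<longlonglongrightarrow> u a - u b"
    by (intro tendsto_diff hat_approximates_delta u) (use ab in auto)
  obtain N :: nat where N: "1 / (T - b) < real N" using reals_Archimedean2 by blast
  have "integral {0..T} (\<lambda>t. ?k n a t *\<^sub>R u t) - integral {0..T} (\<lambda>t. ?k n b t *\<^sub>R u t) = - (LINT t|?M. ?\<phi> n t *\<^sub>R w t)"
    if n: "N \<le> n" for n
  proof -
    have *: "1 / (T - b) < real n" using N n by (meson of_nat_le_iff order_less_le_trans)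
    have "0 < 1 / (T - b)" using ab by simp
    then have "0 < real n" using * by (rule order_less_trans)
    then have n0: "0 < n" and nb: "b + 1 / real n < T" using * ab by (simp_all add: divide_simps) (simp add: algebra_simps)
    have ck: "continuous_on {0..T} (\<lambda>t. ?k n c t *\<^sub>R u t)" for c
      by (intro continuous_intros u continuous_on_compose2[OF continuous_on_hat[of UNIV]]) auto
    have ik: "(\<lambda>t. ?k n c t *\<^sub>R u t) integrable_on {0..T}" for c
      by (rule integrable_continuous_real[OF ck])
    have "integral {0..T} (\<lambda>t. ?k n a t *\<^sub>R u t) - integral {0..T} (\<lambda>t. ?k n b t *\<^sub>R u t)
      = integral {0..T} (\<lambda>t. ?k n a t *\<^sub>R u t - ?k n b t *\<^sub>R u t)"
      by (rule Henstock_Kurzweil_Integration.integral_diff[OF ik ik, symmetric])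
    also have "\<dots> = (LINT t|?M. ?k n a t *\<^sub>R u t - ?k n b t *\<^sub>R u t)"
    proof (rule LINT_Ioo_eq_integral[symmetric])
      have "(\<lambda>t. ?k n a t *\<^sub>R u t - ?k n b t *\<^sub>R u t) absolutely_integrable_on {0<..<T}"
        using absolutely_integrable_continuous_real[OF continuous_on_diff[OF ck ck]]
        by (simp add: absolutely_integrable_on_Icc_iff_Ioo)
      then show "integrable ?M (\<lambda>t. ?k n a t *\<^sub>R u t - ?k n b t *\<^sub>R u t)"
        by (rule absolutely_integrable_imp_integrable) simp
    qed
    also have "\<dots> = - (LINT t|?M. ?\<phi> n t *\<^sub>R w t)"
      using bspec[OF weak[unfolded has_weak_deriv_def] smooth_bump_test_function(1)[OF ab(1,2) nb n0]]
      unfolding smooth_bump_test_function(2)[OF ab(1,2) nb n0] scaleR_diff_left by simp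
    finally show ?thesis .
  qed
  then have "(\<lambda>n. - (LINT t|?M. ?\<phi> n t *\<^sub>R w t)) \<longlonglongrightarrow> u a - u b"
    by (intro Lim_transform_eventually[OF 2]) (auto simp: eventually_sequentially)
  from LIMSEQ_unique[OF this tendsto_minus[OF 1]] show ?thesis by (simp add: algebra_simps)
qed

text \<open>\<open>u\<close> minus the primitive of \<open>w\<close> takes equal values at any two
  interior points; continuity carries the constant to the endpoints.\<close>

lemma has_weak_deriv_imp_has_L2_deriv:
  fixes u :: "real \<Rightarrow> 'b::euclidean_space"
  assumes T: "0 < T" and u: "continuous_on {0..T} u" and w: "w \<in> L2 (lebesgue_on {0<..<T})"
    and weak: "has_weak_deriv {0<..<T} 1 u w"
  shows "has_L2_deriv T u w"
proof -
  have wi: "w integrable_on {0..T}"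
    using L2_Ioo_absolutely_integrable[OF w] by (simp add: absolutely_integrable_on_def)
  define F where "F t = u t - integral {0..t} w" for t
  have F: "continuous_on {0..T} F"
    unfolding F_def by (intro continuous_intros u indefinite_integral_continuous_1 wi)
  have le: "F t = F s" if "0 < s" "s < t" "t < T" for s t
  proof -
    have "integral {0..s} w + integral {s..t} w = integral {0..t} w"
      using that by (intro Henstock_Kurzweil_Integration.integral_combine integrable_subinterval_real[OF wi]) auto
    moreover have "u t - u s = integral {s..t} w" by (rule weak_deriv_interval[OF u w weak that])
    ultimately show ?thesis by (simp add: F_def algebra_simps)
  qed
  have const: "F t = F (T/2)" if "t \<in> {0<..<T}" for t
    using le[of t "T/2"] le[of "T/2" t] that T by (cases t "T/2" rule: linorder_cases) auto
  have cl: "F t = F (T/2)" if "t \<in> {0..T}" for t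
    by (rule continuous_constant_on_closure[of "{0<..<T}" F "F (T/2)" t, OF _ const])
      (use F that T in simp_all)
  have "u t = u 0 + integral {0..t} w" if "t \<in> {0..T}" for t
  proof -
    have "F t = F 0" by (rule trans[OF cl[OF that] cl[of 0, symmetric]]) (use T in simp)
    then show ?thesis by (simp add: F_def diff_eq_eq)
  qed
  then show ?thesis unfolding has_L2_deriv_def using w by blast
qed

section \<open>Uniqueness of the derivative, and the norm of H^1(0,T)\<close>

lemma AE_eq_0_of_integral_Icc_eq_0:
  fixes f :: "real \<Rightarrow> 'b::euclidean_space"
  assumes f: "f absolutely_integrable_on {0..T}"
    and z: "\<And>s t. \<lbrakk>0 < s; s < t; t < T\<rbrakk> \<Longrightarrow> integral {s..t} f = 0"
  shows "AE t in lebesgue_on {0<..<T}. f t = 0"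
proof -
  let ?f = "\<lambda>t. if t \<in> {0..T} then f t else 0"
  have "?f absolutely_integrable_on UNIV" using f by (simp only: absolutely_integrable_restrict_UNIV)
  then have "?f integrable_on UNIV" by (simp add: absolutely_integrable_on_def)
  then have "?f integrable_on cbox a b" for a b by (rule integrable_on_subcbox) simp
  \<comment> \<open>Lebesgue differentiation: off a negligible set the averages over [x, x + h]
    converge to the value at x. For interior x these averages are 0 as soon as x + h < T.\<close>
  from integrable_ccontinuous_explicit[of ?f, OF this] obtain N where N: "negligible N"
    "\<And>x e. \<lbrakk>x \<notin> N; 0 < e\<rbrakk> \<Longrightarrow> \<exists>d>0. \<forall>h. 0 < h \<and> h < d \<longrightarrow>
      norm (integral (cbox x (x + h *\<^sub>R One)) ?f /\<^sub>R h ^ DIM(real) - ?f x) < e" by blast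
  have "f x = 0" if x: "x \<in> {0<..<T}" "x \<notin> N" for x
  proof (rule ccontr)
    assume "f x \<noteq> 0"
    then obtain d where d: "d > 0" "\<And>h. 0 < h \<Longrightarrow> h < d \<Longrightarrow>
      norm (integral {x..x + h} ?f /\<^sub>R h - ?f x) < norm (f x)"
      using N(2)[of x "norm (f x)"] x by auto
    define h where "h = min d (T - x) / 2"
    have h: "0 < h" "h < d" "x + h < T" using d x by (auto simp: h_def min_def field_simps)
    have "integral {x..x + h} ?f = integral {x..x + h} f"
      by (rule Henstock_Kurzweil_Integration.integral_cong) (use x h in auto)
    also have "\<dots> = 0" using z[of x "x + h"] x h by simp
    finally show False using d(2)[OF h(1,2)] x by simp
  qed
  moreover have "AE x in lebesgue. x \<notin> N"
    using N(1) by (intro AE_not_in) (simp add: negligible_iff_null_sets)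
  ultimately have "AE x in lebesgue. x \<in> {0<..<T} \<longrightarrow> f x = 0" by auto
  then show ?thesis by (subst AE_restrict_space_iff) auto
qed

lemma has_L2_deriv_unique:
  fixes u :: "real \<Rightarrow> 'b::euclidean_space"
  assumes v: "has_L2_deriv T u v" and w: "has_L2_deriv T u w"
  shows "AE t in lebesgue_on {0<..<T}. v t = w t"
proof -
  have "AE t in lebesgue_on {0<..<T}. v t - w t = 0"
  proof (rule AE_eq_0_of_integral_Icc_eq_0)
    show "(\<lambda>t. v t - w t) absolutely_integrable_on {0..T}"
      by (intro set_integral_diff has_L2_derivD(2)[OF v] has_L2_derivD(2)[OF w])
    fix s t assume st: "0 < s" "s < t" "t < T"
    then show "integral {s..t} (\<lambda>t. v t - w t) = 0"
      using has_L2_derivD(4,5)[OF v, of s t] has_L2_derivD(4,5)[OF w, of s t]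
      by (subst Henstock_Kurzweil_Integration.integral_diff) auto
  qed
  then show ?thesis by simp
qed

lemma H1T_iff:
  fixes u :: "real \<Rightarrow> 'b::euclidean_space"
  assumes T: "0 < T"
  shows "u \<in> H1T T \<longleftrightarrow> (\<exists>w. has_L2_deriv T u w) \<and> (\<forall>t. t \<notin> {0..T} \<longrightarrow> u t = 0)"
proof
  assume "u \<in> H1T T"
  then show "(\<exists>w. has_L2_deriv T u w) \<and> (\<forall>t. t \<notin> {0..T} \<longrightarrow> u t = 0)"
    using has_weak_deriv_imp_has_L2_deriv[OF T] unfolding H1T_def H1_def by auto
next
  assume "(\<exists>w. has_L2_deriv T u w) \<and> (\<forall>t. t \<notin> {0..T} \<longrightarrow> u t = 0)"
  then obtain w where w: "has_L2_deriv T u w" and 0: "\<forall>t. t \<notin> {0..T} \<longrightarrow> u t = 0" by blast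
  note c = has_L2_derivD(6)[OF w]
  have "bounded (u ` {0..T})" by (intro compact_imp_bounded compact_continuous_image c) auto
  then obtain B where "\<And>t. t \<in> {0..T} \<Longrightarrow> norm (u t) \<le> B" unfolding bounded_iff by blast
  then have "u \<in> L2 (lebesgue_on {0<..<T})"
    by (intro L2_finite_measure_bounded[OF finite_measure_Ioo continuous_on_Icc_measurable[OF c], where B = B]) auto
  then show "u \<in> H1T T" unfolding H1T_def H1_def
    using 0 c has_L2_derivD(1)[OF w] has_L2_deriv_imp_has_weak_deriv[OF T w] by auto
qed

text \<open>The norm is defined with a weak derivative picked by \<open>SOME\<close>. Whatever is
  picked is again the derivative of a primitive, hence equals \<open>w\<close> almost everywhere, so
  any known derivative may be used to compute the norm.\<close>

lemma H1T_norm_eq: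
  fixes u :: "real \<Rightarrow> 'b::euclidean_space"
  assumes T: "0 < T" and w: "has_L2_deriv T u w"
  shows "H1T_norm T u = sqrt ((LINT t|lebesgue_on {0<..<T}. (norm (u t))\<^sup>2) +
    (LINT t|lebesgue_on {0<..<T}. (norm (w t))\<^sup>2))"
proof -
  let ?w = "weak_deriv {0<..<T} 1 u"
  have "\<exists>w. w \<in> L2 (lebesgue_on {0<..<T}) \<and> has_weak_deriv {0<..<T} 1 u w"
    using has_L2_derivD(1)[OF w] has_L2_deriv_imp_has_weak_deriv[OF T w] by blast
  from someI_ex[OF this] have "?w \<in> L2 (lebesgue_on {0<..<T})" "has_weak_deriv {0<..<T} 1 u ?w"
    unfolding weak_deriv_def by auto
  then have "has_L2_deriv T u ?w"
    by (intro has_weak_deriv_imp_has_L2_deriv[OF T has_L2_derivD(6)[OF w]])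
  from has_L2_deriv_unique[OF this w]
  have "AE t in lebesgue_on {0<..<T}. ?w t = w t" .
  then have "(LINT t|lebesgue_on {0<..<T}. (norm (?w t))\<^sup>2) = (LINT t|lebesgue_on {0<..<T}. (norm (w t))\<^sup>2)"
    using has_L2_derivD(1)[OF w] has_L2_derivD(1)[OF \<open>has_L2_deriv T u ?w\<close>]
    by (intro integral_cong_AE) (auto dest!: L2_D)
  then show ?thesis by (simp add: H1_norm_def)
qed

section \<open>Chain rule and norm estimates\<close>

lemma L2_sum:
  assumes "finite I" "\<And>i. i \<in> I \<Longrightarrow> f i \<in> L2 M"
  shows "(\<lambda>x. \<Sum>i\<in>I. f i x) \<in> L2 M"
  using assms by (induction I rule: finite_induct) (auto simp: L2_add, simp add: L2_def)

lemma has_L2_deriv_linear: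
  assumes L: "bounded_linear L" and u: "has_L2_deriv T u w"
  shows "has_L2_deriv T (\<lambda>t. L (u t)) (\<lambda>t. L (w t))"
  unfolding has_L2_deriv_def
proof (intro conjI ballI)
  show "(\<lambda>t. L (w t)) \<in> L2 (lebesgue_on {0<..<T})"
    by (rule L2_bounded_linear[OF L has_L2_derivD(1)[OF u]])
  fix t assume t: "t \<in> {0..T}"
  have "L (u t) - L (u 0) = L (u t - u 0)" using bounded_linear.linear[OF L] by (simp add: linear_diff)
  also have "\<dots> = integral {0..t} (\<lambda>t. L (w t))"
    using integral_linear[OF has_L2_derivD(4)[OF u, of 0 t] L] has_L2_derivD(5)[OF u, of 0 t] t by (simp add: o_def)
  finally show "L (u t) = L (u 0) + integral {0..t} (\<lambda>t. L (w t))" by (simp add: algebra_simps)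
qed

lemma has_L2_deriv_add:
  assumes u: "has_L2_deriv T u w" and v: "has_L2_deriv T v z"
  shows "has_L2_deriv T (\<lambda>t. u t + v t) (\<lambda>t. w t + z t)"
  unfolding has_L2_deriv_def
proof (intro conjI ballI)
  show "(\<lambda>t. w t + z t) \<in> L2 (lebesgue_on {0<..<T})"
    by (intro L2_add has_L2_derivD(1)[OF u] has_L2_derivD(1)[OF v])
  fix t assume t: "t \<in> {0..T}"
  then show "u t + v t = u 0 + v 0 + integral {0..t} (\<lambda>t. w t + z t)"
    using has_L2_derivD(4,5)[OF u, of 0 t] has_L2_derivD(4,5)[OF v, of 0 t]
    by (simp add: Henstock_Kurzweil_Integration.integral_add algebra_simps)
qed

text \<open>Continuity is asked of each directional derivative separately, as in
  \<open>C_class\<close>; in finite dimensions this yields continuity in the operator norm by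
  expanding in a basis.\<close>

definition has_C1_deriv ::
    "('a::euclidean_space \<Rightarrow> 'b::euclidean_space) \<Rightarrow> ('a \<Rightarrow> 'a \<Rightarrow> 'b) \<Rightarrow> bool"
  where "has_C1_deriv f f' \<longleftrightarrow> (\<forall>x. (f has_derivative f' x) (at x)) \<and>
    (\<forall>h. continuous_on UNIV (\<lambda>x. f' x h))"

lemma has_C1_derivD:
  assumes "has_C1_deriv f f'"
  shows "(f has_derivative f' x) (at x within S)" "continuous_on S (\<lambda>x. f' x h)" "continuous_on S f"
    "bounded_linear (f' x)" "linear (f' x)"
proof -
  have d: "(f has_derivative f' x) (at x within S)" for x S
    using assms by (auto simp: has_C1_deriv_def intro: has_derivative_at_withinI)
  show "(f has_derivative f' x) (at x within S)" by (rule d)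
  show "continuous_on S f" using d by (rule has_derivative_continuous_on)
  show "continuous_on S (\<lambda>x. f' x h)"
    using assms continuous_on_subset[of UNIV "\<lambda>x. f' x h" S] by (auto simp: has_C1_deriv_def)
  show "bounded_linear (f' x)" by (rule has_derivative_bounded_linear[OF d])
  show "linear (f' x)" by (rule has_derivative_linear[OF d])
qed

text \<open>Each of the finitely many basis directions is uniformly continuous on \<open>K\<close>,
  with tolerance \<epsilon> divided by the dimension; expanding \<open>h\<close> adds the errors up
  to \<epsilon> |h|.\<close>

lemma has_C1_deriv_uniform:
  assumes f: "has_C1_deriv f f'" and K: "compact K" and \<epsilon>: "0 < \<epsilon>"
  obtains \<eta> where "0 < \<eta>" "\<And>p q h. \<lbrakk>p \<in> K; q \<in> K; norm (p - q) < \<eta>\<rbrakk> \<Longrightarrow> norm (f' p h - f' q h) \<le> \<epsilon> * norm h"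
proof -
  let ?n = "real DIM('a)"
  have n: "0 < \<epsilon> / ?n" using \<epsilon> by simp
  have "\<exists>\<eta>>0. \<forall>p\<in>K. \<forall>q\<in>K. norm (p - q) < \<eta> \<longrightarrow> norm (f' p b - f' q b) < \<epsilon> / ?n" for b
    using compact_uniformly_continuous[OF has_C1_derivD(2)[OF f] K, of b] n
    unfolding uniformly_continuous_on_def dist_norm by (metis norm_minus_commute)
  then obtain \<eta> where \<eta>: "\<And>b. 0 < \<eta> b"
    "\<And>b p q. \<lbrakk>p \<in> K; q \<in> K; norm (p - q) < \<eta> b\<rbrakk> \<Longrightarrow> norm (f' p b - f' q b) < \<epsilon> / ?n" by metis
  show ?thesis
  proof (rule that[of "Min (\<eta> ` Basis)"])
    show "0 < Min (\<eta> ` Basis)" using \<eta>(1) by simp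
    fix p q h assume pq: "p \<in> K" "q \<in> K" "norm (p - q) < Min (\<eta> ` Basis)"
    have l: "f' x h = (\<Sum>b\<in>Basis. (h \<bullet> b) *\<^sub>R f' x b)" for x
      using has_C1_derivD(5)[OF f, of x]
      by (subst euclidean_representation[of h, symmetric]) (simp only: linear_sum linear_scale)
    have "norm (f' p h - f' q h) = norm (\<Sum>b\<in>Basis. (h \<bullet> b) *\<^sub>R (f' p b - f' q b))"
      by (simp add: l sum_subtractf scaleR_diff_right)
    also have "\<dots> \<le> (\<Sum>b\<in>(Basis::'a set). norm h * (\<epsilon> / ?n))"
    proof (rule sum_norm_le)
      fix b :: 'a assume b: "b \<in> Basis"
      then have "norm (p - q) < \<eta> b" using pq by auto
      then have "norm (f' p b - f' q b) \<le> \<epsilon> / ?n" using \<eta>(2) pq by (meson less_imp_le)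
      then show "norm ((h \<bullet> b) *\<^sub>R (f' p b - f' q b)) \<le> norm h * (\<epsilon> / ?n)"
        using Basis_le_norm[OF b, of h] mult_mono[of "\<bar>h \<bullet> b\<bar>" "norm h" "norm (f' p b - f' q b)" "\<epsilon> / ?n"]
        by simp
    qed
    also have "\<dots> = \<epsilon> * norm h" by simp
    finally show "norm (f' p h - f' q h) \<le> \<epsilon> * norm h" .
  qed
qed

lemma has_C1_deriv_linearization:
  assumes f: "has_C1_deriv f f'" and B: "0 \<le> B"
    and le: "\<And>x h. x \<in> closed_segment a b \<Longrightarrow> norm (f' x h - f' a h) \<le> B * norm h"
  shows "norm (f b - f a - f' a (b - a)) \<le> B * norm (b - a)"
proof -
  have "norm (f b - f a - f' a (b - a)) \<le> norm (b - a) * B"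
  proof (rule differentiable_bound_linearization[where S = "closed_segment a b"])
    show "a + t *\<^sub>R (b - a) \<in> closed_segment a b" if "t \<in> {0..1}" for t
      using that unfolding closed_segment_def by (auto simp: algebra_simps intro!: exI[of _ t])
    show "onorm (f' x - f' a) \<le> B" if "x \<in> closed_segment a b" for x
      using le[OF that] by (intro onorm_bound B) (simp add: fun_diff_def)
  qed (auto intro: has_C1_derivD(1)[OF f])
  then show ?thesis by (simp add: mult.commute)
qed

text \<open>On [s,t] the defect has two parts: the linearization error of \<open>f\<close> at
  \<gamma>(s), and the error of freezing the derivative at \<gamma>(s) under the integral. Each is
  at most \<epsilon>/2 times the integral of |w|, the first because that integral bounds
  |\<gamma>(t) - \<gamma>(s)|.\<close>

lemma has_L2_deriv_chain:
  fixes \<gamma> :: "real \<Rightarrow> 'a::euclidean_space" and f :: "'a \<Rightarrow> 'b::euclidean_space"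
  assumes f: "has_C1_deriv f f'" and \<gamma>: "has_L2_deriv T \<gamma> w"
  shows "has_L2_deriv T (\<lambda>t. f (\<gamma> t)) (\<lambda>t. f' (\<gamma> t) (w t))"
proof -
  note c\<gamma> = has_L2_derivD(6)[OF \<gamma>]
  let ?h = "\<lambda>t. f' (\<gamma> t) (w t)"
  \<comment> \<open>Expansion in the basis writes the candidate derivative as a finite sum of
    components of \<open>w\<close> times continuous factors, which gives measurability and square
    integrability.\<close>
  have l: "?h = (\<lambda>t. \<Sum>b\<in>Basis. (w t \<bullet> b) *\<^sub>R f' (\<gamma> t) b)"
  proof
    fix t
    show "?h t = (\<Sum>b\<in>Basis. (w t \<bullet> b) *\<^sub>R f' (\<gamma> t) b)"
      using has_C1_derivD(5)[OF f, of "\<gamma> t"]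
      by (subst euclidean_representation[of "w t", symmetric]) (simp only: linear_sum linear_scale)
  qed
  have h: "?h \<in> L2 (lebesgue_on {0<..<T})"
    unfolding l
    by (intro L2_sum finite_Basis L2_bilinear[OF bounded_bilinear.flip[OF bounded_bilinear_scaleR]]
        L2_bounded_linear[OF bounded_linear_inner_left has_L2_derivD(1)[OF \<gamma>]]
        continuous_on_compose2[OF has_C1_derivD(2)[OF f, of UNIV] c\<gamma>]) auto
  have hi: "?h absolutely_integrable_on {0..T}" by (rule L2_Ioo_absolutely_integrable[OF h])
  have hi': "?h integrable_on {s..t}" if "0 \<le> s" "t \<le> T" for s t
    using that absolutely_integrable_on_subinterval[OF hi, of s t]
    by (auto simp: absolutely_integrable_on_def)
  have mi: "(\<lambda>t. norm (w t)) integrable_on {s..t}" if "0 \<le> s" "s \<le> t" "t \<le> T" for s t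
    using has_L2_derivD(3)[OF \<gamma> that] by (auto simp: absolutely_integrable_on_def)
  have "bounded (\<gamma> ` {0..T})" by (intro compact_imp_bounded compact_continuous_image c\<gamma>) auto
  then obtain R where R: "\<And>t. t \<in> {0..T} \<Longrightarrow> norm (\<gamma> t) \<le> R" unfolding bounded_iff by blast
  \<comment> \<open>A ball rather than the image of the path: it is convex, so segments between path
    points stay inside.\<close>
  define K where "K = cball (0::'a) R"
  have \<gamma>K: "\<gamma> t \<in> K" if "t \<in> {0..T}" for t using R[OF that] by (simp add: K_def)
  define E where "E s t = f (\<gamma> t) - f (\<gamma> s) - integral {s..t} ?h" for s t
  have E0: "E 0 t = 0" if t: "0 \<le> t" "t \<le> T" for t
  proof (rule additive_interval_function_eq_0[where E = E and m = "\<lambda>t. norm (w t)" and T = T])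
    show "E 0 t = E 0 s + E s t" if "0 \<le> s" "s \<le> t" "t \<le> T" for s t
      using Henstock_Kurzweil_Integration.integral_combine[OF that(1,2) hi'[of 0 t]] that
      by (simp add: E_def algebra_simps)
    show "(\<lambda>t. norm (w t)) integrable_on {0..T}" using mi[of 0 T] t by auto
    fix \<epsilon> :: real assume \<epsilon>: "0 < \<epsilon>"
    then have e2: "0 < \<epsilon> / 2" by simp
    have "compact K" by (simp add: K_def)
    from has_C1_deriv_uniform[OF f this e2] obtain \<eta> where \<eta>: "0 < \<eta>"
      "\<And>p q h. \<lbrakk>p \<in> K; q \<in> K; norm (p - q) < \<eta>\<rbrakk> \<Longrightarrow> norm (f' p h - f' q h) \<le> \<epsilon> / 2 * norm h" by blast
    from uniformly_continuous_on_Icc[OF c\<gamma> \<eta>(1)] obtain \<delta> where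
      \<delta>: "0 < \<delta>" "\<And>s t. \<lbrakk>s \<in> {0..T}; t \<in> {0..T}; \<bar>t - s\<bar> < \<delta>\<rbrakk> \<Longrightarrow> norm (\<gamma> t - \<gamma> s) < \<eta>" by blast
    show "\<exists>\<delta>>0. \<forall>s t. 0 \<le> s \<longrightarrow> s \<le> t \<longrightarrow> t \<le> T \<longrightarrow> t - s < \<delta> \<longrightarrow>
      norm (E s t) \<le> \<epsilon> * integral {s..t} (\<lambda>t. norm (w t))"
    proof (intro exI[of _ \<delta>] conjI allI impI \<delta>(1))
      fix s t assume st: "0 \<le> s" "s \<le> t" "t \<le> T" "t - s < \<delta>"
      let ?I = "integral {s..t} (\<lambda>t. norm (w t))"
      note iw = has_L2_derivD(4)[OF \<gamma> st(1-3)] and wt = has_L2_derivD(5)[OF \<gamma> st(1-3)]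
      have i1: "(\<lambda>x. f' (\<gamma> s) (w x)) integrable_on {s..t}"
        using integrable_linear[OF iw has_C1_derivD(4)[OF f]] by (simp add: o_def)
      have lin: "integral {s..t} (\<lambda>x. f' (\<gamma> s) (w x)) = f' (\<gamma> s) (\<gamma> t - \<gamma> s)"
        using integral_linear[OF iw has_C1_derivD(4)[OF f, of "\<gamma> s"]] wt by (simp add: o_def)
      have "norm (f (\<gamma> t) - f (\<gamma> s) - f' (\<gamma> s) (\<gamma> t - \<gamma> s)) \<le> \<epsilon> / 2 * norm (\<gamma> t - \<gamma> s)"
      proof (rule has_C1_deriv_linearization[OF f])
        fix x h assume x: "x \<in> closed_segment (\<gamma> s) (\<gamma> t)"
        have "closed_segment (\<gamma> s) (\<gamma> t) \<subseteq> K"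
          using \<gamma>K[of s] \<gamma>K[of t] st by (intro closed_segment_subset) (auto simp: K_def)
        moreover have "norm (x - \<gamma> s) < \<eta>"
          using segment_bound1[OF x] \<delta>(2)[of s t] st by simp
        ultimately show "norm (f' x h - f' (\<gamma> s) h) \<le> \<epsilon> / 2 * norm h"
          using x \<gamma>K[of s] st by (intro \<eta>(2)) auto
      qed (use \<epsilon> in simp)
      also have "norm (\<gamma> t - \<gamma> s) \<le> ?I"
        unfolding wt by (rule Henstock_Kurzweil_Integration.integral_norm_bound_integral[OF iw mi[OF st(1-3)]]) simp
      finally have A: "norm (f (\<gamma> t) - f (\<gamma> s) - f' (\<gamma> s) (\<gamma> t - \<gamma> s)) \<le> \<epsilon> / 2 * ?I"
        using \<epsilon> by simp
      have B: "norm (integral {s..t} (\<lambda>x. f' (\<gamma> s) (w x) - ?h x)) \<le> integral {s..t} (\<lambda>x. \<epsilon> / 2 * norm (w x))"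
      proof (rule Henstock_Kurzweil_Integration.integral_norm_bound_integral)
        show "(\<lambda>x. f' (\<gamma> s) (w x) - ?h x) integrable_on {s..t}"
          using st by (intro integrable_diff i1 hi') auto
        show "(\<lambda>x. \<epsilon> / 2 * norm (w x)) integrable_on {s..t}"
          by (intro integrable_on_mult_right mi st(1-3))
        fix x assume x: "x \<in> {s..t}"
        show "norm (f' (\<gamma> s) (w x) - ?h x) \<le> \<epsilon> / 2 * norm (w x)"
          using x st \<delta>(2)[of x s] by (intro \<eta>(2) \<gamma>K) auto
      qed
      have "E s t = (f (\<gamma> t) - f (\<gamma> s) - f' (\<gamma> s) (\<gamma> t - \<gamma> s)) + integral {s..t} (\<lambda>x. f' (\<gamma> s) (w x) - ?h x)"
        using Henstock_Kurzweil_Integration.integral_diff[OF i1 hi'[of s t]] lin st by (simp add: E_def)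
      also have "norm \<dots> \<le> \<epsilon> / 2 * ?I + \<epsilon> / 2 * ?I"
        using B by (intro order_trans[OF norm_triangle_ineq] add_mono A) simp
      finally show "norm (E s t) \<le> \<epsilon> * ?I" by simp
    qed
  qed (use t in auto)
  show ?thesis unfolding has_L2_deriv_def
  proof (intro conjI ballI h)
    fix t assume "t \<in> {0..T}"
    then have "E 0 t = 0" by (intro E0) auto
    then show "f (\<gamma> t) = f (\<gamma> 0) + integral {0..t} ?h" by (simp add: E_def algebra_simps)
  qed
qed

section \<open>Sup norm and product estimates in H^1(0,T)\<close>

lemma norm_integral_sq_le:
  fixes w :: "real \<Rightarrow> 'b::euclidean_space"
  assumes T: "0 < T" and w: "w \<in> L2 (lebesgue_on {0<..<T})"
  shows "(LINT t|lebesgue_on {0<..<T}. norm (w t))\<^sup>2 \<le> T * (LINT t|lebesgue_on {0<..<T}. (norm (w t))\<^sup>2)"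
proof -
  let ?M = "lebesgue_on {0<..<T}"
  interpret finite_measure ?M by (rule finite_measure_Ioo)
  have meas: "measure ?M (space ?M) = T" using T by (simp add: measure_restrict_space)
  have i: "integrable ?M (\<lambda>t. norm (w t))" using L2_integrable[OF w] by simp
  note i2 = L2_D(2)[OF w]
  \<comment> \<open>\<open>m\<close> is the mean of |w|; Cauchy-Schwarz is the nonnegativity of the
    variance.\<close>
  define m where "m = (LINT t|?M. norm (w t)) / T"
  have "0 \<le> (LINT t|?M. (norm (w t) - m)\<^sup>2)" by simp
  also have "(\<lambda>t. (norm (w t) - m)\<^sup>2) = (\<lambda>t. (norm (w t))\<^sup>2 - 2 * m * norm (w t) + m\<^sup>2)"
    by (auto simp: power2_eq_square algebra_simps)
  also have "(LINT t|?M. (norm (w t))\<^sup>2 - 2 * m * norm (w t) + m\<^sup>2) =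
      (LINT t|?M. (norm (w t))\<^sup>2) - 2 * m * (LINT t|?M. norm (w t)) + m\<^sup>2 * T"
    using i i2 meas by simp
  also have "\<dots> = (LINT t|?M. (norm (w t))\<^sup>2) - (LINT t|?M. norm (w t))\<^sup>2 / T"
    using T by (simp add: m_def power2_eq_square field_simps)
  finally show ?thesis using T by (simp add: field_simps)
qed

lemma H1T_norm_sq:
  fixes u :: "real \<Rightarrow> 'b::euclidean_space"
  assumes "0 < T" "has_L2_deriv T u w"
  shows "(H1T_norm T u)\<^sup>2 = (LINT t|lebesgue_on {0<..<T}. (norm (u t))\<^sup>2) +
    (LINT t|lebesgue_on {0<..<T}. (norm (w t))\<^sup>2)"
  by (simp add: H1T_norm_eq[OF assms])

lemma has_L2_deriv_imp_L2:
  assumes "has_L2_deriv T u w"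
  shows "u \<in> L2 (lebesgue_on {0<..<T})"
proof -
  note c = has_L2_derivD(6)[OF assms]
  have "bounded (u ` {0..T})" by (intro compact_imp_bounded compact_continuous_image c) auto
  then obtain B where "\<And>t. t \<in> {0..T} \<Longrightarrow> norm (u t) \<le> B" unfolding bounded_iff by blast
  then show ?thesis
    by (intro L2_finite_measure_bounded[OF finite_measure_Ioo continuous_on_Icc_measurable[OF c], where B = B]) auto
qed

text \<open>For every s, |u(t)|^2 \<le> 2 |u(s)|^2 + 2 A^2 with A the integral of |w|. Averaging
  over s replaces the unknown u(s) by the L^2 norm and gives the constant 2/T; the constant 2T comes
  from A^2 \<le> T times the squared L^2 norm of \<open>w\<close>.\<close>

lemma sup_norm_le_H1T_norm:
  fixes u :: "real \<Rightarrow> 'b::euclidean_space"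
  assumes T: "0 < T" and u: "has_L2_deriv T u w" and t: "t \<in> {0..T}"
  shows "(norm (u t))\<^sup>2 \<le> (2 / T + 2 * T) * (H1T_norm T u)\<^sup>2"
proof -
  let ?M = "lebesgue_on {0<..<T}"
  interpret finite_measure ?M by (rule finite_measure_Ioo)
  have meas: "measure ?M (space ?M) = T" using T by (simp add: measure_restrict_space)
  note w2 = has_L2_derivD(1)[OF u] and u2 = has_L2_deriv_imp_L2[OF u]
  let ?A = "LINT t|?M. norm (w t)" and ?U = "LINT t|?M. (norm (u t))\<^sup>2" and ?W = "LINT t|?M. (norm (w t))\<^sup>2"
  have iw: "integrable ?M (\<lambda>t. norm (w t))" using L2_integrable[OF w2] by simp
  have A: "?A = integral {0..T} (\<lambda>t. norm (w t))" by (rule LINT_Ioo_eq_integral[OF iw])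
  have d: "norm (u b - u a) \<le> ?A" if "0 \<le> a" "a \<le> b" "b \<le> T" for a b
  proof -
    have n: "(\<lambda>t. norm (w t)) integrable_on {0..T}"
      using has_L2_derivD(2)[OF u] by (simp add: absolutely_integrable_on_def)
    have ni: "(\<lambda>t. norm (w t)) integrable_on {a..b}"
      using that by (intro integrable_subinterval_real[OF n]) auto
    have "norm (u b - u a) \<le> integral {a..b} (\<lambda>t. norm (w t))"
      unfolding has_L2_derivD(5)[OF u that]
      by (rule Henstock_Kurzweil_Integration.integral_norm_bound_integral[OF has_L2_derivD(4)[OF u that] ni]) simp
    also have "\<dots> \<le> ?A" unfolding A
      using that by (intro integral_subset_le ni n) auto
    finally show ?thesis .
  qed
  have "(norm (u t))\<^sup>2 \<le> 2 * (norm (u s))\<^sup>2 + 2 * ?A\<^sup>2" if "s \<in> space ?M" for s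
  proof -
    have "norm (u t - u s) \<le> ?A"
      using that t d[of s t] d[of t s] by (cases "s \<le> t") (auto simp: norm_minus_commute)
    then have "(norm (u t - u s))\<^sup>2 \<le> ?A\<^sup>2" by (intro power_mono) auto
    moreover have "(norm (u t))\<^sup>2 \<le> 2 * (norm (u s))\<^sup>2 + 2 * (norm (u t - u s))\<^sup>2"
      using norm_add_sq_le[of "u s" "u t - u s"] by simp
    ultimately show ?thesis by linarith
  qed
  then have "(LINT s|?M. (norm (u t))\<^sup>2) \<le> (LINT s|?M. 2 * (norm (u s))\<^sup>2 + 2 * ?A\<^sup>2)"
    using L2_D(2)[OF u2] by (intro integral_mono) auto
  then have "T * (norm (u t))\<^sup>2 \<le> 2 * ?U + 2 * T * ?A\<^sup>2"
    using L2_D(2)[OF u2] meas by (simp add: mult.commute mult.left_commute)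
  also have "\<dots> \<le> 2 * ?U + 2 * T * (T * ?W)"
    using norm_integral_sq_le[OF T w2] T by (intro add_mono mult_left_mono) auto
  finally have "(norm (u t))\<^sup>2 \<le> 2 / T * ?U + 2 * T * ?W"
    using T by (simp add: field_simps)
  also have "\<dots> \<le> (2 / T + 2 * T) * ?U + (2 / T + 2 * T) * ?W"
    using T by (intro add_mono mult_right_mono) auto
  finally show ?thesis unfolding H1T_norm_sq[OF T u] by (simp add: distrib_left)
qed

lemma H1_norm_nonneg: "0 \<le> H1_norm D u"
  by (simp add: H1_norm_def sum_nonneg)

lemma H1T_D:
  assumes "0 < T" "u \<in> H1T T"
  obtains w where "has_L2_deriv T u w" "\<And>t. t \<notin> {0..T} \<Longrightarrow> u t = 0"
  using assms H1T_iff by blast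

text \<open>The derivative of the product contains the product of \<open>g\<close> and
  \<open>v\<close> with \<open>g\<close> merely square integrable, so \<open>v\<close> has to be
  taken out in the sup norm. The estimate makes v |-> v N(\<gamma>) continuous on H^1, hence the
  multiplier a bounded functional.\<close>

lemma H1T_norm_bilinear_le:
  fixes f :: "real \<Rightarrow> 'a::euclidean_space" and mul :: "'a \<Rightarrow> 'b::euclidean_space \<Rightarrow> 'c::euclidean_space"
  assumes T: "0 < T" and b: "bounded_bilinear mul" and f: "has_L2_deriv T f g"
  shows "\<exists>C. \<forall>v\<in>H1T T. H1T_norm T (\<lambda>t. mul (f t) (v t)) \<le> C * H1T_norm T v"
proof -
  interpret bounded_bilinear mul by (rule b)
  let ?M = "lebesgue_on {0<..<T}"
  obtain K where K: "0 < K" "\<And>a b. norm (mul a b) \<le> norm a * norm b * K" using pos_bounded by blast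
  have "bounded (f ` {0..T})" by (intro compact_imp_bounded compact_continuous_image has_L2_derivD(6)[OF f]) auto
  then obtain F where F: "0 < F" "\<And>t. t \<in> {0..T} \<Longrightarrow> norm (f t) \<le> F" unfolding bounded_pos by auto
  define G where "G = (LINT t|?M. (norm (g t))\<^sup>2)"
  have G: "0 \<le> G" by (simp add: G_def)
  note g2 = L2_D(2)[OF has_L2_derivD(1)[OF f]]
  define c where "c = 2 / T + 2 * T"
  have c: "0 \<le> c" using T by (simp add: c_def)
  \<comment> \<open>The first summand bounds the function values; the other two bound the two terms
    of the derivative, doubled by the inequality for the square of a sum.\<close>
  define C where "C = K\<^sup>2 * F\<^sup>2 + 2 * K\<^sup>2 * F\<^sup>2 + 2 * K\<^sup>2 * c * G"
  have "H1T_norm T (\<lambda>t. mul (f t) (v t)) \<le> sqrt C * H1T_norm T v" if v: "v \<in> H1T T" for v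
  proof -
    obtain z where z: "has_L2_deriv T v z" using H1T_D[OF T v] by blast
    note z2 = L2_D(2)[OF has_L2_derivD(1)[OF z]] and v2 = L2_D(2)[OF has_L2_deriv_imp_L2[OF z]]
    let ?N = "H1T_norm T v" and ?V = "LINT t|?M. (norm (v t))\<^sup>2" and ?Z = "LINT t|?M. (norm (z t))\<^sup>2"
    note P = has_L2_deriv_bilinear[OF b f z]
    have N: "?N\<^sup>2 = ?V + ?Z" by (rule H1T_norm_sq[OF T z])
    have nn: "0 \<le> ?V" "0 \<le> ?Z" by auto
    have p1: "(norm (mul (f t) y))\<^sup>2 \<le> K\<^sup>2 * F\<^sup>2 * (norm y)\<^sup>2" if "t \<in> space ?M" for t y
    proof -
      have "norm (mul (f t) y) \<le> F * norm y * K"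
        using that F K by (intro order_trans[OF K(2)] mult_right_mono) auto
      then have "(norm (mul (f t) y))\<^sup>2 \<le> (F * norm y * K)\<^sup>2" by (intro power_mono) auto
      then show ?thesis by (simp add: power_mult_distrib mult_ac)
    qed
    have A: "(LINT t|?M. (norm (mul (f t) (v t)))\<^sup>2) \<le> (LINT t|?M. K\<^sup>2 * F\<^sup>2 * (norm (v t))\<^sup>2)"
      by (intro integral_mono p1 L2_D(2) has_L2_deriv_imp_L2[OF P]) (use v2 in simp_all)
    have B: "(LINT t|?M. (norm (mul (f t) (z t) + mul (g t) (v t)))\<^sup>2) \<le>
        (LINT t|?M. 2 * K\<^sup>2 * F\<^sup>2 * (norm (z t))\<^sup>2 + 2 * K\<^sup>2 * c * ?N\<^sup>2 * (norm (g t))\<^sup>2)"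
    proof (intro integral_mono L2_D(2)[OF has_L2_derivD(1)[OF P]])
      show "integrable ?M (\<lambda>t. 2 * K\<^sup>2 * F\<^sup>2 * (norm (z t))\<^sup>2 + 2 * K\<^sup>2 * c * ?N\<^sup>2 * (norm (g t))\<^sup>2)"
        using z2 g2 by simp
      fix t assume t: "t \<in> space ?M"
      have "(norm (mul (g t) (v t)))\<^sup>2 \<le> (norm (g t) * norm (v t) * K)\<^sup>2" by (intro power_mono K(2)) auto
      also have "\<dots> = K\<^sup>2 * (norm (v t))\<^sup>2 * (norm (g t))\<^sup>2" by (simp add: power_mult_distrib mult_ac)
      also have "(norm (v t))\<^sup>2 \<le> c * ?N\<^sup>2"
        using sup_norm_le_H1T_norm[OF T z, of t] t by (simp add: c_def)
      finally have q: "(norm (mul (g t) (v t)))\<^sup>2 \<le> K\<^sup>2 * (c * ?N\<^sup>2) * (norm (g t))\<^sup>2"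
        by (simp add: mult_left_mono mult_right_mono)
      have "(norm (mul (f t) (z t) + mul (g t) (v t)))\<^sup>2 \<le>
          2 * (norm (mul (f t) (z t)))\<^sup>2 + 2 * (norm (mul (g t) (v t)))\<^sup>2" by (rule norm_add_sq_le)
      then show "(norm (mul (f t) (z t) + mul (g t) (v t)))\<^sup>2 \<le>
          2 * K\<^sup>2 * F\<^sup>2 * (norm (z t))\<^sup>2 + 2 * K\<^sup>2 * c * ?N\<^sup>2 * (norm (g t))\<^sup>2"
        using p1[OF t, of "z t"] q by (simp add: mult.assoc)
    qed
    have "(H1T_norm T (\<lambda>t. mul (f t) (v t)))\<^sup>2 \<le>
        K\<^sup>2 * F\<^sup>2 * ?V + (2 * K\<^sup>2 * F\<^sup>2 * ?Z + 2 * K\<^sup>2 * c * ?N\<^sup>2 * G)"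
      unfolding H1T_norm_sq[OF T P] using A B z2 g2 v2 by (simp add: G_def)
    also have "\<dots> \<le> K\<^sup>2 * F\<^sup>2 * ?N\<^sup>2 + (2 * K\<^sup>2 * F\<^sup>2 * ?N\<^sup>2 + 2 * K\<^sup>2 * c * ?N\<^sup>2 * G)"
      using nn c G unfolding N by (intro add_mono mult_left_mono mult_right_mono) auto
    also have "\<dots> = C * ?N\<^sup>2" by (simp add: C_def algebra_simps)
    finally have "H1T_norm T (\<lambda>t. mul (f t) (v t)) \<le> sqrt (C * ?N\<^sup>2)" by (rule real_le_rsqrt)
    then show ?thesis by (simp add: real_sqrt_mult H1_norm_nonneg)
  qed
  then show ?thesis by blast
qed

section \<open>Linearised constraints along a feasible path\<close>

lemma C_class_continuous: "C_class n f \<Longrightarrow> continuous_on UNIV f"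
proof (cases n)
  case (Suc k)
  assume "C_class n f"
  then have "f differentiable_on UNIV" using Suc by (simp add: differentiable_on_def)
  then show ?thesis by (rule differentiable_imp_continuous_on)
qed simp

lemma C_class_has_C1_deriv:
  assumes "C_class (Suc n) f"
  shows "has_C1_deriv f (\<lambda>x. frechet_derivative f (at x))"
  using assms C_class_continuous[of n] by (auto simp: has_C1_deriv_def frechet_derivative_works)

section \<open>Closure properties and Lipschitz bounds of C^1 maps\<close>

lemma has_C1_deriv_bilinear:
  fixes mul :: "'b::euclidean_space \<Rightarrow> 'c::euclidean_space \<Rightarrow> 'd::euclidean_space"
  assumes "bounded_bilinear mul" "has_C1_deriv f f'" "has_C1_deriv g g'"
  shows "has_C1_deriv (\<lambda>x. mul (f x) (g x)) (\<lambda>x h. mul (f x) (g' x h) + mul (f' x h) (g x))"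
  unfolding has_C1_deriv_def
  by (intro conjI allI bounded_bilinear.FDERIV[OF assms(1)] continuous_on_add
      bounded_bilinear.continuous_on[OF assms(1)] has_C1_derivD[OF assms(2)] has_C1_derivD[OF assms(3)])

lemma has_C1_deriv_add:
  assumes "has_C1_deriv f f'" "has_C1_deriv g g'"
  shows "has_C1_deriv (\<lambda>x. f x + g x) (\<lambda>x h. f' x h + g' x h)"
  unfolding has_C1_deriv_def
  by (intro conjI allI has_derivative_add continuous_on_add has_C1_derivD[OF assms(1)] has_C1_derivD[OF assms(2)])

lemma has_C1_deriv_sum:
  assumes "\<And>i. i \<in> I \<Longrightarrow> has_C1_deriv (f i) (f' i)"
  shows "has_C1_deriv (\<lambda>x. \<Sum>i\<in>I. f i x) (\<lambda>x h. \<Sum>i\<in>I. f' i x h)"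
  unfolding has_C1_deriv_def
  by (intro conjI allI has_derivative_sum continuous_on_sum has_C1_derivD[OF assms])

lemma has_C1_deriv_scaleR_const:
  assumes "has_C1_deriv f f'"
  shows "has_C1_deriv (\<lambda>x. f x *\<^sub>R c) (\<lambda>x h. f' x h *\<^sub>R c)"
  unfolding has_C1_deriv_def
  by (intro conjI allI has_derivative_scaleR_left continuous_intros has_C1_derivD[OF assms])

lemma has_C1_deriv_inverse:
  fixes f :: "'a::euclidean_space \<Rightarrow> real"
  assumes f: "has_C1_deriv f f'" and nz: "\<And>x. f x \<noteq> 0"
  shows "has_C1_deriv (\<lambda>x. inverse (f x)) (\<lambda>x h. - (inverse (f x) * f' x h * inverse (f x)))"
  unfolding has_C1_deriv_def
proof (intro conjI allI)
  show "((\<lambda>x. inverse (f x)) has_derivative (\<lambda>h. - (inverse (f x) * f' x h * inverse (f x)))) (at x)" for x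
    by (rule Deriv.has_derivative_inverse[OF nz has_C1_derivD(1)[OF f]])
  show "continuous_on UNIV (\<lambda>x. - (inverse (f x) * f' x h * inverse (f x)))" for h
    using nz by (intro continuous_intros has_C1_derivD[OF f]) auto
qed

text \<open>The derivative is bounded on the compact set in each basis direction, and the sum of
  these bounds is the constant. Applied to the gradient of \<open>g\<close>, it controls the second
  order Taylor remainder.\<close>

lemma has_C1_deriv_Lipschitz:
  fixes f :: "'a::euclidean_space \<Rightarrow> 'b::euclidean_space"
  assumes f: "has_C1_deriv f f'" and K: "compact K" "convex K"
  obtains M where "0 \<le> M" "\<And>x y. \<lbrakk>x \<in> K; y \<in> K\<rbrakk> \<Longrightarrow> norm (f x - f y) \<le> M * norm (x - y)"
proof -
  have "bounded ((\<lambda>x. f' x b) ` K)" for b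
    by (intro compact_imp_bounded compact_continuous_image has_C1_derivD(2)[OF f] K)
  then have "\<exists>B. 0 < B \<and> (\<forall>x\<in>K. norm (f' x b) \<le> B)" for b unfolding bounded_pos by auto
  then obtain B where B: "\<And>b. 0 < B b" "\<And>b x. x \<in> K \<Longrightarrow> norm (f' x b) \<le> B b" by metis
  define M where "M = (\<Sum>b\<in>Basis. B b)"
  have M: "0 \<le> M" using B(1) unfolding M_def by (intro sum_nonneg) (simp add: less_imp_le)
  have on: "onorm (f' x) \<le> M" if x: "x \<in> K" for x
  proof (rule onorm_bound[OF M])
    fix h
    have "f' x h = (\<Sum>b\<in>Basis. (h \<bullet> b) *\<^sub>R f' x b)"
      using has_C1_derivD(5)[OF f, of x]
      by (subst euclidean_representation[of h, symmetric]) (simp only: linear_sum linear_scale)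
    also have "norm \<dots> \<le> (\<Sum>b\<in>Basis. B b * norm h)"
    proof (rule sum_norm_le)
      fix b :: 'a assume b: "b \<in> Basis"
      show "norm ((h \<bullet> b) *\<^sub>R f' x b) \<le> B b * norm h"
        using Basis_le_norm[OF b, of h] B(2)[OF x, of b] mult_mono[of "norm (f' x b)" "B b" "\<bar>h \<bullet> b\<bar>" "norm h"] B(1)[of b]
        by (simp add: mult.commute less_imp_le)
    qed
    finally show "norm (f' x h) \<le> M * norm h" by (simp add: M_def sum_distrib_right)
  qed
  have "norm (f x - f y) \<le> M * norm (x - y)" if "x \<in> K" "y \<in> K" for x y
    by (rule differentiable_bound[OF K(2) has_C1_derivD(1)[OF f] on that])
  with M that show ?thesis by blast
qed

section \<open>Algebraic operations in H^1(0,T)\<close>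

lemma H1T_linear:
  assumes T: "0 < T" and L: "bounded_linear L" and u: "u \<in> H1T T"
  shows "(\<lambda>t. L (u t)) \<in> H1T T"
proof -
  obtain w where w: "has_L2_deriv T u w" and "\<And>t. t \<notin> {0..T} \<Longrightarrow> u t = 0" using H1T_D[OF T u] by blast
  then have "\<forall>t. t \<notin> {0..T} \<longrightarrow> L (u t) = 0" using linear_0[OF bounded_linear.linear[OF L]] by simp
  then show ?thesis unfolding H1T_iff[OF T] using has_L2_deriv_linear[OF L w] by blast
qed

lemma H1T_add:
  assumes T: "0 < T" and u: "u \<in> H1T T" and v: "v \<in> H1T T"
  shows "u + v \<in> H1T T"
proof -
  obtain w where w: "has_L2_deriv T u w" and u0: "\<And>t. t \<notin> {0..T} \<Longrightarrow> u t = 0" using H1T_D[OF T u] by blast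
  obtain z where z: "has_L2_deriv T v z" and v0: "\<And>t. t \<notin> {0..T} \<Longrightarrow> v t = 0" using H1T_D[OF T v] by blast
  have "\<forall>t. t \<notin> {0..T} \<longrightarrow> u t + v t = 0" using u0 v0 by simp
  then show ?thesis unfolding H1T_iff[OF T] plus_fun_def using has_L2_deriv_add[OF w z] by blast
qed

lemma H1T_scaleR:
  assumes T: "0 < T" and u: "u \<in> H1T T"
  shows "c *\<^sub>R u \<in> H1T T"
  using H1T_linear[OF T bounded_linear_scaleR_right u] by (simp add: scaleR_fun_def)

lemma H1T_diff:
  assumes T: "0 < T" and u: "u \<in> H1T T" and v: "v \<in> H1T T"
  shows "u - v \<in> H1T T"
  using H1T_add[OF T u H1T_scaleR[OF T v, of "-1"]] by (simp add: fun_eq_iff scaleR_fun_def fun_diff_def plus_fun_def)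

lemma H1T_norm_scaleR:
  fixes u :: "real \<Rightarrow> 'b::euclidean_space"
  assumes T: "0 < T" and u: "u \<in> H1T T"
  shows "H1T_norm T (c *\<^sub>R u) = \<bar>c\<bar> * H1T_norm T u"
proof -
  obtain w where w: "has_L2_deriv T u w" using H1T_D[OF T u] by blast
  have "(H1T_norm T (c *\<^sub>R u))\<^sup>2 = (\<bar>c\<bar> * H1T_norm T u)\<^sup>2"
    using H1T_norm_sq[OF T has_L2_deriv_linear[OF bounded_linear_scaleR_right w, of c]] H1T_norm_sq[OF T w]
    by (simp add: scaleR_fun_def power_mult_distrib distrib_left)
  then show ?thesis by (subst (asm) power2_eq_iff_nonneg) (auto simp: H1_norm_nonneg)
qed

text \<open>The factor 2 absorbs the loss in (a + b)^2 \<le> 2 a^2 + 2 b^2. The estimate serves to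
  show convergence to 0, where a constant factor is harmless.\<close>

lemma H1T_norm_add_le:
  fixes u :: "real \<Rightarrow> 'b::euclidean_space"
  assumes T: "0 < T" and u: "u \<in> H1T T" and v: "v \<in> H1T T"
  shows "H1T_norm T (u + v) \<le> 2 * (H1T_norm T u + H1T_norm T v)"
proof -
  let ?M = "lebesgue_on {0<..<T}"
  obtain w where w: "has_L2_deriv T u w" using H1T_D[OF T u] by blast
  obtain z where z: "has_L2_deriv T v z" using H1T_D[OF T v] by blast
  note a = has_L2_deriv_add[OF w z]
  have *: "(LINT t|?M. (norm (f t + g t))\<^sup>2) \<le> 2 * (LINT t|?M. (norm (f t))\<^sup>2) + 2 * (LINT t|?M. (norm (g t))\<^sup>2)"
    if "f \<in> L2 ?M" "g \<in> L2 ?M" for f g :: "real \<Rightarrow> 'b"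
  proof -
    have "(LINT t|?M. (norm (f t + g t))\<^sup>2) \<le> (LINT t|?M. 2 * (norm (f t))\<^sup>2 + 2 * (norm (g t))\<^sup>2)"
      using L2_D(2)[OF that(1)] L2_D(2)[OF that(2)]
      by (intro integral_mono L2_D(2)[OF L2_add[OF that]] norm_add_sq_le) simp
    then show ?thesis using L2_D(2)[OF that(1)] L2_D(2)[OF that(2)] by simp
  qed
  have "(H1T_norm T (u + v))\<^sup>2 \<le> 2 * (H1T_norm T u)\<^sup>2 + 2 * (H1T_norm T v)\<^sup>2"
    using *[OF has_L2_deriv_imp_L2[OF w] has_L2_deriv_imp_L2[OF z]] *[OF has_L2_derivD(1)[OF w] has_L2_derivD(1)[OF z]]
    by (simp add: plus_fun_def H1T_norm_sq[OF T a] H1T_norm_sq[OF T w] H1T_norm_sq[OF T z])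
  also have "\<dots> \<le> (2 * (H1T_norm T u + H1T_norm T v))\<^sup>2"
    using H1_norm_nonneg[of "{0<..<T}" u] H1_norm_nonneg[of "{0<..<T}" v]
    by (simp add: power2_eq_square algebra_simps)
  finally show ?thesis
    by (rule power2_le_imp_le) (simp add: H1_norm_nonneg)
qed

lemma H1T_bilinear:
  fixes f :: "real \<Rightarrow> 'a::euclidean_space" and v :: "real \<Rightarrow> 'b::euclidean_space"
    and mul :: "'a \<Rightarrow> 'b \<Rightarrow> 'c::euclidean_space"
  assumes T: "0 < T" and b: "bounded_bilinear mul" and f: "has_L2_deriv T f g" and v: "v \<in> H1T T"
  shows "(\<lambda>t. mul (f t) (v t)) \<in> H1T T"
proof -
  obtain w where w: "has_L2_deriv T v w" and "\<And>t. t \<notin> {0..T} \<Longrightarrow> v t = 0" using H1T_D[OF T v] by blast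
  then have "\<forall>t. t \<notin> {0..T} \<longrightarrow> mul (f t) (v t) = 0" using bounded_bilinear.zero_right[OF b] by simp
  then show ?thesis unfolding H1T_iff[OF T] using has_L2_deriv_bilinear[OF b f w] by blast
qed

lemma has_L2_deriv_cong:
  assumes "has_L2_deriv T u w" "\<And>t. t \<in> {0..T} \<Longrightarrow> v t = u t"
  shows "has_L2_deriv T v w"
  unfolding has_L2_deriv_def
proof (intro conjI ballI)
  show "w \<in> L2 (lebesgue_on {0<..<T})" by (rule has_L2_derivD(1)[OF assms(1)])
  fix t assume t: "t \<in> {0..T}"
  then have "u t - u 0 = integral {0..t} w" by (intro has_L2_derivD(5)[OF assms(1)]) auto
  then show "v t = v 0 + integral {0..t} w" using assms(2)[OF t] assms(2)[of 0] t by (simp add: algebra_simps)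
qed

lemma H1T_compose:
  fixes \<gamma> :: "real \<Rightarrow> 'a::euclidean_space" and f :: "'a \<Rightarrow> 'b::euclidean_space"
  assumes T: "0 < T" and f: "has_C1_deriv f f'" and \<gamma>: "\<gamma> \<in> H1T T"
  shows "(\<lambda>t. if t \<in> {0..T} then f (\<gamma> t) else 0) \<in> H1T T"
proof -
  obtain w where w: "has_L2_deriv T \<gamma> w" using H1T_D[OF T \<gamma>] by blast
  have "has_L2_deriv T (\<lambda>t. if t \<in> {0..T} then f (\<gamma> t) else 0) (\<lambda>t. f' (\<gamma> t) (w t))"
    by (rule has_L2_deriv_cong[OF has_L2_deriv_chain[OF f w]]) simp
  then show ?thesis by (auto simp: H1T_iff[OF T])
qed

lemma continuous_on_Icc_bounded:
  fixes u :: "real \<Rightarrow> 'b::real_normed_vector"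
  assumes "continuous_on {0..T} u"
  obtains B where "0 < B" "\<And>t. t \<in> {0..T} \<Longrightarrow> norm (u t) \<le> B"
  using compact_imp_bounded[OF compact_continuous_image[OF assms]] unfolding bounded_pos by auto

text \<open>Isolates the pointwise constraint from the heat problem: \<open>n\<close> stands for the
  gradient of \<open>g\<close>, and the cost enters only later, as an abstract functional
  \<open>J\<close>. The path is fixed because all cones and multipliers are taken at one
  point.\<close>

locale regular_constraint =
  fixes T :: real and g :: "'a::euclidean_space \<Rightarrow> real" and n :: "'a \<Rightarrow> 'a" and n' :: "'a \<Rightarrow> 'a \<Rightarrow> 'a"
    and \<gamma> :: "real \<Rightarrow> 'a"
  assumes T: "0 < T"
    and g: "has_C1_deriv g (\<lambda>x h. n x \<bullet> h)" and n: "has_C1_deriv n n'"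
    and regular: "\<And>x. g x = 0 \<Longrightarrow> n x \<noteq> 0"
    and \<gamma>: "\<gamma> \<in> H1T T" and feasible: "\<And>t. t \<in> {0..T} \<Longrightarrow> g (\<gamma> t) \<le> 0"
begin

text \<open>The field \<open>N = n / (|n|\<^sup>2 + g\<^sup>2)\<close> is defined everywhere, so no cutoff near \<open>g = 0\<close> is needed; the
  defect \<open>1 - n \<bullet> N\<close> is \<open>g\<^sup>2 / (|n|\<^sup>2 + g\<^sup>2)\<close>, which is dominated by \<open>-g\<close> along the feasible path.\<close>

definition p :: "'a \<Rightarrow> real" where "p x = n x \<bullet> n x + g x * g x"
definition N :: "'a \<Rightarrow> 'a" where "N x = inverse (p x) *\<^sub>R n x"
definition \<omega> :: "'a \<Rightarrow> real" where "\<omega> x = inverse (p x) * (g x * g x)"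

lemma p_pos: "0 < p x"
proof (cases "g x = 0")
  case True
  then show ?thesis using regular[of x] by (simp add: p_def)
next
  case False
  then have "0 < g x * g x" by (metis not_square_less_zero less_linear mult_eq_0_iff)
  then show ?thesis unfolding p_def by (meson add_nonneg_pos inner_ge_zero)
qed

lemma inner_N: "n x \<bullet> N x = 1 - \<omega> x"
proof -
  have "n x \<bullet> N x + \<omega> x = inverse (p x) * p x"
    by (simp add: N_def \<omega>_def p_def[of x] distrib_left)
  then show ?thesis using p_pos[of x] by simp
qed

lemma \<omega>_bounds: "0 \<le> \<omega> x" "\<omega> x \<le> 1"
proof -
  show "0 \<le> \<omega> x" using p_pos[of x] by (simp add: \<omega>_def)
  have "0 \<le> n x \<bullet> N x" using p_pos[of x] by (simp add: N_def)
  then show "\<omega> x \<le> 1" by (simp add: inner_N)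
qed

lemma C1_p: "\<exists>p'. has_C1_deriv p p'"
  using has_C1_deriv_add[OF has_C1_deriv_bilinear[OF bounded_bilinear_inner n n]
      has_C1_deriv_bilinear[OF bounded_bilinear_mult g g]]
  by (auto simp: p_def[abs_def])

lemma C1_inverse_p: "\<exists>p'. has_C1_deriv (\<lambda>x. inverse (p x)) p'"
proof -
  obtain p' where "has_C1_deriv p p'" using C1_p by blast
  from has_C1_deriv_inverse[OF this] p_pos show ?thesis by (simp add: less_imp_neq[symmetric]) blast
qed

lemma C1_N: "\<exists>N'. has_C1_deriv N N'"
proof -
  obtain q where "has_C1_deriv (\<lambda>x. inverse (p x)) q" using C1_inverse_p by blast
  from has_C1_deriv_bilinear[OF bounded_bilinear_scaleR this n] show ?thesis unfolding N_def[abs_def] by blast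
qed

lemma C1_\<omega>: "\<exists>\<omega>'. has_C1_deriv \<omega> \<omega>'"
proof -
  obtain q where "has_C1_deriv (\<lambda>x. inverse (p x)) q" using C1_inverse_p by blast
  from has_C1_deriv_bilinear[OF bounded_bilinear_mult this has_C1_deriv_bilinear[OF bounded_bilinear_mult g g]]
  show ?thesis unfolding \<omega>_def[abs_def] by blast
qed

lemma path_deriv:
  assumes "has_C1_deriv f f'"
  obtains w where "has_L2_deriv T (\<lambda>t. f (\<gamma> t)) w"
proof -
  obtain w where "has_L2_deriv T \<gamma> w" using H1T_D[OF T \<gamma>] by blast
  from that[OF has_L2_deriv_chain[OF assms this]] show ?thesis .
qed

text \<open>\<open>lift\<close>, \<open>rest\<close> and \<open>DG\<close> are linear and inherit
  the vanishing outside [0,T] from their argument. \<open>Gp\<close> does not: \<gamma> is 0 there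
  and g(0) may be any number, hence the explicit cutoff.\<close>

definition lift :: "(real \<Rightarrow> real) \<Rightarrow> real \<Rightarrow> 'a" where "lift v = (\<lambda>t. v t *\<^sub>R N (\<gamma> t))"
definition rest :: "(real \<Rightarrow> real) \<Rightarrow> real \<Rightarrow> real" where "rest v = (\<lambda>t. \<omega> (\<gamma> t) * v t)"
definition DG :: "(real \<Rightarrow> 'a) \<Rightarrow> real \<Rightarrow> real" where "DG d = (\<lambda>t. n (\<gamma> t) \<bullet> d t)"
definition Gp :: "real \<Rightarrow> real" where "Gp = (\<lambda>t. if t \<in> {0..T} then g (\<gamma> t) else 0)"

section \<open>The splitting of H^1(0,T) along the path\<close>

lemma Gp_H1T: "Gp \<in> H1T T"
  unfolding Gp_def by (rule H1T_compose[OF T g \<gamma>])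

lemma DG_H1T:
  assumes "d \<in> H1T T"
  shows "DG d \<in> H1T T"
proof -
  obtain w where "has_L2_deriv T (\<lambda>t. n (\<gamma> t)) w" using path_deriv[OF n] .
  from H1T_bilinear[OF T bounded_bilinear_inner this assms] show ?thesis by (simp add: DG_def)
qed

lemma rest_H1T:
  assumes "v \<in> H1T T"
  shows "rest v \<in> H1T T"
proof -
  obtain \<omega>' where "has_C1_deriv \<omega> \<omega>'" using C1_\<omega> by blast
  then obtain w where "has_L2_deriv T (\<lambda>t. \<omega> (\<gamma> t)) w" by (rule path_deriv)
  from H1T_bilinear[OF T bounded_bilinear_mult this assms] show ?thesis by (simp add: rest_def)
qed

lemma N_path_deriv:
  obtains w where "has_L2_deriv T (\<lambda>t. N (\<gamma> t)) w"
proof -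
  obtain N' where "has_C1_deriv N N'" using C1_N by blast
  then show ?thesis by (rule path_deriv) (rule that)
qed

lemma lift_H1T:
  assumes "v \<in> H1T T"
  shows "lift v \<in> H1T T"
proof -
  obtain w where "has_L2_deriv T (\<lambda>t. N (\<gamma> t)) w" by (rule N_path_deriv)
  from H1T_bilinear[OF T bounded_bilinear.flip[OF bounded_bilinear_scaleR] this assms]
  show ?thesis by (simp add: lift_def)
qed

lemma lift_bounded: "\<exists>C. \<forall>v\<in>H1T T. H1T_norm T (lift v) \<le> C * H1T_norm T v"
proof -
  obtain w where "has_L2_deriv T (\<lambda>t. N (\<gamma> t)) w" by (rule N_path_deriv)
  from H1T_norm_bilinear_le[OF T bounded_bilinear.flip[OF bounded_bilinear_scaleR] this]
  show ?thesis unfolding lift_def .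
qed

lemma lift_add: "lift (u + v) = lift u + lift v"
  and lift_scaleR: "lift (c *\<^sub>R u) = c *\<^sub>R lift u"
  by (auto simp: lift_def fun_eq_iff scaleR_fun_def scaleR_left_distrib)

lemma DG_lift: "DG (lift v) + rest v = v"
  by (auto simp: DG_def lift_def rest_def inner_N fun_eq_iff algebra_simps)

text \<open>What is left of \<open>d\<close> after removing its normal part has a linearised
  constraint of the form \<open>rest\<close>, which the slack absorbs with either sign.\<close>

lemma DG_diff_lift_DG: "DG (d - lift (DG d)) = rest (DG d)"
  by (auto simp: DG_def lift_def rest_def inner_diff_right inner_N fun_eq_iff algebra_simps)

text \<open>\<omega> is -g times -g/p; the factor -g/p is continuous along the path, hence bounded
  on [0,T], and -g is nonnegative by feasibility.\<close>

lemma \<omega>_le: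
  obtains k where "0 < k" "\<And>t. t \<in> {0..T} \<Longrightarrow> \<omega> (\<gamma> t) \<le> k * - g (\<gamma> t)"
proof -
  obtain w where "has_L2_deriv T \<gamma> w" using H1T_D[OF T \<gamma>] by blast
  then have c: "continuous_on {0..T} \<gamma>" by (rule has_L2_derivD)
  obtain p' where p': "has_C1_deriv (\<lambda>x. inverse (p x)) p'" using C1_inverse_p by blast
  have "continuous_on {0..T} (\<lambda>t. inverse (p (\<gamma> t)) * g (\<gamma> t))"
    by (intro continuous_intros continuous_on_compose2[OF has_C1_derivD(3)[OF p', of UNIV] c]
        continuous_on_compose2[OF has_C1_derivD(3)[OF g, of UNIV] c]) auto
  from continuous_on_Icc_bounded[OF this] obtain k where k: "0 < k"
    "\<And>t. t \<in> {0..T} \<Longrightarrow> \<bar>inverse (p (\<gamma> t)) * g (\<gamma> t)\<bar> \<le> k" by auto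
  have "\<omega> (\<gamma> t) \<le> k * - g (\<gamma> t)" if t: "t \<in> {0..T}" for t
  proof -
    have "\<omega> (\<gamma> t) = - (inverse (p (\<gamma> t)) * g (\<gamma> t)) * - g (\<gamma> t)" by (simp add: \<omega>_def)
    also have "\<dots> \<le> k * - g (\<gamma> t)"
      using k(2)[OF t] feasible[OF t] by (intro mult_right_mono) auto
    finally show ?thesis .
  qed
  with k that show ?thesis by blast
qed

lemma rest_absorbed:
  assumes v: "v \<in> H1T T"
  obtains \<epsilon> where "0 < \<epsilon>" "\<And>t. t \<in> {0..T} \<Longrightarrow> g (\<gamma> t) + \<epsilon> * \<bar>rest v t\<bar> \<le> 0"
proof -
  obtain w where "has_L2_deriv T v w" using H1T_D[OF T v] by blast
  from continuous_on_Icc_bounded[OF has_L2_derivD(6)[OF this]] obtain S where S: "0 < S"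
    "\<And>t. t \<in> {0..T} \<Longrightarrow> \<bar>v t\<bar> \<le> S" by auto
  obtain k where k: "0 < k" "\<And>t. t \<in> {0..T} \<Longrightarrow> \<omega> (\<gamma> t) \<le> k * - g (\<gamma> t)" using \<omega>_le by blast
  \<comment> \<open>With |v| \<le> S the rest is bounded by k S times the slack, which dictates
    \<epsilon> = 1 / (k S).\<close>
  have "g (\<gamma> t) + 1 / (k * S) * \<bar>rest v t\<bar> \<le> 0" if t: "t \<in> {0..T}" for t
  proof -
    have "\<bar>rest v t\<bar> = \<omega> (\<gamma> t) * \<bar>v t\<bar>" using \<omega>_bounds by (simp add: rest_def abs_mult)
    also have "\<dots> \<le> (k * - g (\<gamma> t)) * S"
      using k t S(2)[OF t] \<omega>_bounds(1)[of "\<gamma> t"] feasible[OF t]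
      by (intro mult_mono k(2)) (auto simp: mult_nonneg_nonpos)
    finally show ?thesis using k(1) S(1) by (simp add: field_simps)
  qed
  with k S that[of "1 / (k * S)"] show ?thesis by simp
qed

text \<open>The slack -g is spent in two halves: one on the linear term, as the step is at most
  t0/2, the other on the defect \<omega>, by which the normal correction falls short of its nominal
  size. The rest of the correction pays for the Taylor remainder.\<close>

lemma linearized_direction_tangent:
  assumes d: "d \<in> H1T T" and t0: "0 < t0"
    and lin: "\<And>t. t \<in> {0..T} \<Longrightarrow> g (\<gamma> t) + t0 * DG d t \<le> 0"
  shows "d \<in> tangent_cone (H1T T) (H1T_norm T) {\<gamma> \<in> H1T T. \<forall>t\<in>{0..T}. g (\<gamma> t) \<le> 0} \<gamma>"
proof -
  \<comment> \<open>The field N along the path as an element of H^1(0,T), obtained by lifting the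
    constant 1 cut off outside [0,T].\<close>
  define e where "e = lift (\<lambda>t. if t \<in> {0..T} then 1 else 0)"
  have "(\<lambda>t. if t \<in> {0..T} then 1 else 0::real) \<in> H1T T"
  proof (rule H1T_compose[OF T _ \<gamma>])
    show "has_C1_deriv (\<lambda>x::'a. 1::real) (\<lambda>x h. 0)" by (simp add: has_C1_deriv_def)
  qed
  then have e: "e \<in> H1T T" unfolding e_def by (rule lift_H1T)
  have eN: "e t = N (\<gamma> t)" if "t \<in> {0..T}" for t using that by (simp add: e_def lift_def)
  obtain w where "has_L2_deriv T \<gamma> w" using H1T_D[OF T \<gamma>] by blast
  from continuous_on_Icc_bounded[OF has_L2_derivD(6)[OF this]] obtain R where R: "0 < R"
    "\<And>t. t \<in> {0..T} \<Longrightarrow> norm (\<gamma> t) \<le> R" by blast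
  obtain w where "has_L2_deriv T d w" using H1T_D[OF T d] by blast
  from continuous_on_Icc_bounded[OF has_L2_derivD(6)[OF this]] obtain D where D: "0 < D"
    "\<And>t. t \<in> {0..T} \<Longrightarrow> norm (d t) \<le> D" by blast
  obtain w where "has_L2_deriv T e w" using H1T_D[OF T e] by blast
  from continuous_on_Icc_bounded[OF has_L2_derivD(6)[OF this]] obtain L where L: "0 < L"
    "\<And>t. t \<in> {0..T} \<Longrightarrow> norm (e t) \<le> L" by blast
  obtain k where k: "0 < k" "\<And>t. t \<in> {0..T} \<Longrightarrow> \<omega> (\<gamma> t) \<le> k * - g (\<gamma> t)" using \<omega>_le by blast
  \<comment> \<open>The radius R + 1 leaves room for increments of norm at most 1.\<close>
  let ?K = "cball (0::'a) (R + 1)"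
  obtain M where M: "0 \<le> M" "\<And>x y. \<lbrakk>x \<in> ?K; y \<in> ?K\<rbrakk> \<Longrightarrow> norm (n x - n y) \<le> M * norm (x - y)"
    using has_C1_deriv_Lipschitz[OF n, of ?K] by auto
  have taylor: "g (\<gamma> t + h) \<le> g (\<gamma> t) + n (\<gamma> t) \<bullet> h + M * (norm h)\<^sup>2" if t: "t \<in> {0..T}" and h: "norm h \<le> 1" for t h
  proof -
    have "norm (g (\<gamma> t + h) - g (\<gamma> t) - n (\<gamma> t) \<bullet> ((\<gamma> t + h) - \<gamma> t)) \<le> (M * norm h) * norm ((\<gamma> t + h) - \<gamma> t)"
    proof (rule has_C1_deriv_linearization[OF g])
      show "0 \<le> M * norm h" using M by simp
      fix x y :: 'a assume x: "x \<in> closed_segment (\<gamma> t) (\<gamma> t + h)"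
      have "norm (\<gamma> t + h) \<le> R + 1" using norm_triangle_ineq[of "\<gamma> t" h] R(2)[OF t] h by linarith
      then have "closed_segment (\<gamma> t) (\<gamma> t + h) \<subseteq> ?K"
        using R(2)[OF t] by (intro closed_segment_subset) auto
      then have "norm (n x - n (\<gamma> t)) \<le> M * norm (x - \<gamma> t)" using x R(2)[OF t] by (intro M(2)) auto
      also have "\<dots> \<le> M * norm h" using segment_bound1[OF x] M(1) by (intro mult_left_mono) auto
      finally have "norm (n x - n (\<gamma> t)) * norm y \<le> M * norm h * norm y" by (rule mult_right_mono) simp
      then show "norm (n x \<bullet> y - n (\<gamma> t) \<bullet> y) \<le> M * norm h * norm y"
        using Cauchy_Schwarz_ineq2[of "n x - n (\<gamma> t)" y] by (simp add: inner_diff_left)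
    qed
    then show ?thesis by (simp add: power2_eq_square abs_le_iff mult_ac)
  qed
  \<comment> \<open>The increments will satisfy |h| \<le> s (D + 1), so the remainder M |h|^2 is at
    most C s^2.\<close>
  define C where "C = M * (D + 1)\<^sup>2"
  have C: "0 \<le> C" using M by (simp add: C_def)
  \<comment> \<open>The bound t0/2 limits the linear term to half of the slack; 1/(D + 1) keeps the
    increment in the unit ball; 1/(C L + 1) makes the correction at most s in norm; 1 and 1/(2 C k +
    1) together limit the defect to the other half of the slack. The last two denominators stay
    positive for C = 0.\<close>
  define s0 where "s0 = Min {1, t0 / 2, 1 / (D + 1), 1 / (C * L + 1), 1 / (2 * C * k + 1)}"
  have s0: "0 < s0" using t0 D L k C by (simp add: s0_def add_nonneg_pos)
  have feas: "g (\<gamma> t + (s *\<^sub>R d t - (C * s\<^sup>2) *\<^sub>R e t)) \<le> 0" if s: "0 < s" "s \<le> s0" and t: "t \<in> {0..T}" for s t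
  proof -
    let ?h = "s *\<^sub>R d t - (C * s\<^sup>2) *\<^sub>R e t"
    have b: "s \<le> 1" "s \<le> t0 / 2" "s \<le> 1 / (D + 1)" "s \<le> 1 / (C * L + 1)" "s \<le> 1 / (2 * C * k + 1)"
      using s by (auto simp: s0_def)
    have "0 \<le> C * L" "0 \<le> C * k" using C L k by auto
    then have b2: "s * (D + 1) \<le> 1" "s * (C * L) \<le> 1" "C * s * k \<le> 1 / 2"
      using b(3,4,5) s D by (simp_all add: pos_le_divide_eq distrib_left mult_ac)
    have "norm ?h \<le> norm (s *\<^sub>R d t) + norm ((C * s\<^sup>2) *\<^sub>R e t)" by (rule norm_triangle_ineq4)
    also have "\<dots> \<le> s * D + C * s\<^sup>2 * L"
      using s C D(2)[OF t] L(2)[OF t] by (simp add: add_mono mult_left_mono)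
    also have "\<dots> = s * (D + s * (C * L))" by (simp add: power2_eq_square algebra_simps)
    also have "\<dots> \<le> s * (D + 1)" using b2 s by (intro mult_left_mono) auto
    finally have h: "norm ?h \<le> s * (D + 1)" .
    have "M * (norm ?h)\<^sup>2 \<le> M * (s * (D + 1))\<^sup>2" using h M by (intro mult_left_mono power_mono) auto
    also have "\<dots> = C * s\<^sup>2" by (simp add: C_def power_mult_distrib mult_ac)
    finally have q: "M * (norm ?h)\<^sup>2 \<le> C * s\<^sup>2" .
    have "C * s\<^sup>2 * \<omega> (\<gamma> t) \<le> C * s\<^sup>2 * (k * - g (\<gamma> t))" using C k(2)[OF t] by (intro mult_left_mono) auto
    also have "\<dots> = (s * (C * s * k)) * - g (\<gamma> t)" by (simp add: power2_eq_square mult_ac)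
    also have "\<dots> \<le> (1 * (1 / 2)) * - g (\<gamma> t)"
      using b2 b s C k feasible[OF t] by (intro mult_right_mono mult_mono) auto
    finally have o: "C * s\<^sup>2 * \<omega> (\<gamma> t) \<le> 1 / 2 * - g (\<gamma> t)" by simp
    have l: "s * (n (\<gamma> t) \<bullet> d t) \<le> 1 / 2 * - g (\<gamma> t)"
    proof -
      have "n (\<gamma> t) \<bullet> d t \<le> - g (\<gamma> t) / t0" using lin[OF t] t0 by (simp add: DG_def field_simps)
      then have "s * (n (\<gamma> t) \<bullet> d t) \<le> s * (- g (\<gamma> t) / t0)" using s by (intro mult_left_mono) auto
      also have "\<dots> = (s / t0) * - g (\<gamma> t)" by simp
      also have "\<dots> \<le> 1 / 2 * - g (\<gamma> t)"
        using b(2) t0 feasible[OF t] by (intro mult_right_mono) (auto simp: field_simps)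
      finally show ?thesis .
    qed
    have "norm ?h \<le> 1" using h b2 by linarith
    from taylor[OF t this] have "g (\<gamma> t + ?h) \<le> g (\<gamma> t) + n (\<gamma> t) \<bullet> ?h + C * s\<^sup>2" using q by linarith
    \<comment> \<open>The correction contributes - C s^2, which cancels the Taylor bound, and leaves
      C s^2 \<omega>(\<gamma> t).\<close>
    also have "n (\<gamma> t) \<bullet> ?h = s * (n (\<gamma> t) \<bullet> d t) - C * s\<^sup>2 * (1 - \<omega> (\<gamma> t))"
      by (simp add: inner_diff_right eN[OF t] inner_N)
    finally show ?thesis using o l by (simp add: algebra_simps)
  qed
  define \<sigma> where "\<sigma> m = s0 / real (Suc m)" for m
  have \<sigma>: "0 < \<sigma> m" "\<sigma> m \<le> s0" for m using s0 by (auto simp: \<sigma>_def divide_le_eq mult_le_cancel_left1)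
  have \<sigma>0: "\<sigma> \<longlonglongrightarrow> 0" unfolding \<sigma>_def by (rule LIMSEQ_Suc[OF lim_const_over_n])
  define W where "W m = \<gamma> + (\<sigma> m *\<^sub>R d + (- (C * (\<sigma> m)\<^sup>2)) *\<^sub>R e)" for m
  have "W m \<in> H1T T" for m unfolding W_def by (intro H1T_add[OF T] H1T_scaleR[OF T] \<gamma> d e)
  moreover have "g (W m t) \<le> 0" if "t \<in> {0..T}" for m t
    using feas[OF \<sigma>[of m] that] by (simp add: W_def scaleR_fun_def plus_fun_def)
  moreover have "(\<lambda>m. H1T_norm T (W m - \<gamma>)) \<longlonglongrightarrow> 0"
  proof (rule tendsto_sandwich[OF _ _ tendsto_const])
    show "\<forall>\<^sub>F m in sequentially. 0 \<le> H1T_norm T (W m - \<gamma>)" by (simp add: H1_norm_nonneg)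
    have "H1T_norm T (W m - \<gamma>) \<le> 2 * (\<sigma> m * H1T_norm T d + C * (\<sigma> m)\<^sup>2 * H1T_norm T e)" for m
    proof -
      have "W m - \<gamma> = \<sigma> m *\<^sub>R d + (- (C * (\<sigma> m)\<^sup>2)) *\<^sub>R e" by (simp add: W_def)
      then have "H1T_norm T (W m - \<gamma>) \<le> 2 * (\<bar>\<sigma> m\<bar> * H1T_norm T d + \<bar>- (C * (\<sigma> m)\<^sup>2)\<bar> * H1T_norm T e)"
        using H1T_norm_add_le[OF T H1T_scaleR[OF T d, of "\<sigma> m"] H1T_scaleR[OF T e, of "- (C * (\<sigma> m)\<^sup>2)"]]
        by (simp only: H1T_norm_scaleR[OF T d] H1T_norm_scaleR[OF T e])
      then show ?thesis using \<sigma>(1)[of m] C by (simp add: abs_mult)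
    qed
    then show "\<forall>\<^sub>F m in sequentially. H1T_norm T (W m - \<gamma>) \<le> 2 * (\<sigma> m * H1T_norm T d + C * (\<sigma> m)\<^sup>2 * H1T_norm T e)"
      by simp
    show "(\<lambda>m. 2 * (\<sigma> m * H1T_norm T d + C * (\<sigma> m)\<^sup>2 * H1T_norm T e)) \<longlonglongrightarrow> 0"
      using \<sigma>0 by (auto intro!: tendsto_eq_intros)
  qed
  moreover have "(\<lambda>m. H1T_norm T ((1 / \<sigma> m) *\<^sub>R (W m - \<gamma>) - d)) \<longlonglongrightarrow> 0"
  proof -
    \<comment> \<open>The quotient misses \<open>d\<close> by exactly - C \<sigma>(m) e, a fixed H^1
      function with a factor tending to 0.\<close>
    have "H1T_norm T ((1 / \<sigma> m) *\<^sub>R (W m - \<gamma>) - d) = C * \<sigma> m * H1T_norm T e" for m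
    proof -
      have "(1 / \<sigma> m) *\<^sub>R (W m - \<gamma>) - d = (- (C * \<sigma> m)) *\<^sub>R e"
        using \<sigma>(1)[of m] by (auto simp: W_def fun_eq_iff scaleR_fun_def power2_eq_square algebra_simps)
      then show ?thesis using C \<sigma>(1)[of m] by (simp only: H1T_norm_scaleR[OF T e]) (simp add: abs_mult)
    qed
    then show ?thesis using \<sigma>0 by (auto intro!: tendsto_eq_intros)
  qed
  ultimately show ?thesis unfolding tangent_cone_def using d \<sigma>(1) \<sigma>0 by blast
qed

end

section \<open>Multipliers\<close>

definition gradient :: "('a::euclidean_space \<Rightarrow> real) \<Rightarrow> 'a \<Rightarrow> 'a"
  where "gradient f x = (\<Sum>b\<in>Basis. frechet_derivative f (at x) b *\<^sub>R b)"

lemma inner_gradient: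
  assumes "f differentiable (at x)"
  shows "gradient f x \<bullet> h = frechet_derivative f (at x) h"
proof -
  have l: "linear (frechet_derivative f (at x))" by (rule linear_frechet_derivative[OF assms])
  have "frechet_derivative f (at x) h = (\<Sum>b\<in>Basis. (h \<bullet> b) * frechet_derivative f (at x) b)"
    by (subst euclidean_representation[of h, symmetric]) (simp only: linear_sum[OF l] linear_scale[OF l] real_scaleR_def)
  then show ?thesis by (simp add: gradient_def inner_sum_left inner_commute[of h] mult.commute)
qed

lemma C_class_has_C1_deriv_gradient:
  assumes "C_class (Suc n) f"
  shows "has_C1_deriv f (\<lambda>x h. gradient f x \<bullet> h)"
proof -
  have "(\<lambda>x h. gradient f x \<bullet> h) = (\<lambda>x. frechet_derivative f (at x))"
    using assms by (auto simp: fun_eq_iff inner_gradient)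
  then show ?thesis using C_class_has_C1_deriv[OF assms] by simp
qed

lemma C_class_gradient_has_C1_deriv:
  assumes "C_class (Suc (Suc n)) f"
  shows "\<exists>f''. has_C1_deriv (gradient f) f''"
proof -
  have "has_C1_deriv (\<lambda>x. frechet_derivative f (at x) b *\<^sub>R b)
      (\<lambda>x h. frechet_derivative (\<lambda>x. frechet_derivative f (at x) b) (at x) h *\<^sub>R b)" for b
    using assms by (intro has_C1_deriv_scaleR_const C_class_has_C1_deriv[of n]) simp
  then have "has_C1_deriv (\<lambda>x. \<Sum>b\<in>Basis. frechet_derivative f (at x) b *\<^sub>R b)
      (\<lambda>x h. \<Sum>b\<in>Basis. frechet_derivative (\<lambda>x. frechet_derivative f (at x) b) (at x) h *\<^sub>R b)"
    by (rule has_C1_deriv_sum)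
  then show ?thesis unfolding gradient_def[abs_def] by blast
qed

context regular_constraint
begin

section \<open>Normal cone, radial cone and multiplier of the path constraint\<close>

lemma normal_cone_vanishes_on_rest:
  assumes l: "l \<in> normal_cone (H1T T) (H1T_norm T) (K_cone T) Gp" and v: "v \<in> H1T T"
  shows "l (rest v) = 0"
proof -
  obtain \<epsilon> where \<epsilon>: "0 < \<epsilon>" "\<And>t. t \<in> {0..T} \<Longrightarrow> g (\<gamma> t) + \<epsilon> * \<bar>rest v t\<bar> \<le> 0"
    using rest_absorbed[OF v] by blast
  have "c * l (rest v) \<le> 0" if c: "\<bar>c\<bar> = \<epsilon>" for c
  proof -
    have le: "c * rest v t \<le> \<epsilon> * \<bar>rest v t\<bar>" for t using abs_ge_self[of "c * rest v t"] c by (simp add: abs_mult)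
    have "Gp + c *\<^sub>R rest v \<in> H1T T" by (intro H1T_add[OF T] H1T_scaleR[OF T] Gp_H1T rest_H1T v)
    moreover have "(Gp + c *\<^sub>R rest v) t \<le> 0" if "t \<in> {0..T}" for t
      using \<epsilon>(2)[OF that] le[of t] that by (simp add: plus_fun_def scaleR_fun_def Gp_def)
    ultimately have "Gp + c *\<^sub>R rest v \<in> K_cone T" by (simp add: K_cone_def)
    then have "l ((Gp + c *\<^sub>R rest v) - Gp) \<le> 0" using l by (simp only: normal_cone_def mem_Collect_eq)
    then have "l (c *\<^sub>R rest v) \<le> 0" by simp
    then show ?thesis using l rest_H1T[OF v] by (auto simp: normal_cone_def dual_def)
  qed
  from this[of \<epsilon>] this[of "- \<epsilon>"] \<epsilon>(1) show ?thesis by (simp add: mult_le_0_iff zero_le_mult_iff)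
qed

text \<open>The sign is arranged for a Minkowski difference: subtracting the cone element
  \<open>- rest v\<close> adds \<open>rest v\<close>.\<close>

lemma rest_radial:
  assumes v: "v \<in> H1T T"
  obtains s z where "0 \<le> s" "z \<in> K_cone T" "rest v = - (s *\<^sub>R (z - Gp))"
proof -
  obtain \<epsilon> where \<epsilon>: "0 < \<epsilon>" "\<And>t. t \<in> {0..T} \<Longrightarrow> g (\<gamma> t) + \<epsilon> * \<bar>rest v t\<bar> \<le> 0"
    using rest_absorbed[OF v] by blast
  let ?z = "Gp - \<epsilon> *\<^sub>R rest v"
  have le: "- \<epsilon> * rest v t \<le> \<epsilon> * \<bar>rest v t\<bar>" for t
    using abs_ge_self[of "- \<epsilon> * rest v t"] \<epsilon>(1) by (simp add: abs_mult)
  have "?z \<in> H1T T" by (intro H1T_diff[OF T] H1T_scaleR[OF T] Gp_H1T rest_H1T v)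
  moreover have "?z t \<le> 0" if "t \<in> {0..T}" for t
    using \<epsilon>(2)[OF that] le[of t] that by (simp add: fun_diff_def scaleR_fun_def Gp_def)
  ultimately have "?z \<in> K_cone T" by (simp add: K_cone_def)
  moreover have "rest v = - ((1 / \<epsilon>) *\<^sub>R (?z - Gp))" using \<epsilon>(1) by simp
  ultimately show ?thesis using that[of "1 / \<epsilon>" ?z] \<epsilon>(1) by simp
qed

lemma multiplier_unique:
  assumes "l \<in> normal_cone (H1T T) (H1T_norm T) (K_cone T) Gp" "\<forall>d\<in>H1T T. J d + l (DG d) = 0"
    and "m \<in> normal_cone (H1T T) (H1T_norm T) (K_cone T) Gp" "\<forall>d\<in>H1T T. J d + m (DG d) = 0"
  shows "l = m"
proof
  fix v
  show "l v = m v"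
  proof (cases "v \<in> H1T T")
    \<comment> \<open>Functionals are normalised to vanish off the carrier, so equality as functions
      holds there too.\<close>
    case False
    then show ?thesis using assms(1,3) by (simp add: normal_cone_def dual_def)
  next
    case True
    have "k v = - J (lift v)"
      if k: "k \<in> normal_cone (H1T T) (H1T_norm T) (K_cone T) Gp" "\<forall>d\<in>H1T T. J d + k (DG d) = 0" for k
    proof -
      have "k v = k (DG (lift v) + rest v)" by (simp add: DG_lift)
      also have "\<dots> = k (DG (lift v)) + k (rest v)"
        using k(1) DG_H1T[OF lift_H1T[OF True]] rest_H1T[OF True] by (auto simp: normal_cone_def dual_def)
      also have "\<dots> = - J (lift v)"
        using normal_cone_vanishes_on_rest[OF k(1) True] bspec[OF k(2) lift_H1T[OF True]] by simp
      finally show ?thesis .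
    qed
    then show ?thesis using assms by metis
  qed
qed

text \<open>The tangency of linearised directions is used twice: for \<open>lift (z - Gp)\<close>,
  which gives the sign condition of the normal cone, and for plus and minus
  \<open>d - lift (DG d)\<close>, which gives the equation. Boundedness of \<open>l\<close> is that
  of \<open>J\<close> combined with that of \<open>lift\<close>.\<close>

lemma multiplier_exists:
  assumes add: "\<And>x y. \<lbrakk>x \<in> H1T T; y \<in> H1T T\<rbrakk> \<Longrightarrow> J (x + y) = J x + J y"
    and scale: "\<And>a x. x \<in> H1T T \<Longrightarrow> J (a *\<^sub>R x) = a * J x"
    and bdd: "\<And>x. x \<in> H1T T \<Longrightarrow> \<bar>J x\<bar> \<le> C * H1T_norm T x"
    and foc: "\<And>d. d \<in> tangent_cone (H1T T) (H1T_norm T) {\<gamma> \<in> H1T T. \<forall>t\<in>{0..T}. g (\<gamma> t) \<le> 0} \<gamma> \<Longrightarrow> 0 \<le> J d"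
  shows "\<exists>l\<in>normal_cone (H1T T) (H1T_norm T) (K_cone T) Gp. \<forall>d\<in>H1T T. J d + l (DG d) = 0"
proof -
  define l where "l v = (if v \<in> H1T T then - J (lift v) else 0)" for v
  have lin: "0 \<le> J d" if d: "d \<in> H1T T" "0 < t0" "\<And>t. t \<in> {0..T} \<Longrightarrow> g (\<gamma> t) + t0 * DG d t \<le> 0" for d t0
    by (rule foc[OF linearized_direction_tangent[OF d]])
  have "l \<in> dual (H1T T) (H1T_norm T)"
    unfolding dual_def
  proof (intro CollectI conjI ballI allI impI)
    show "l (x + y) = l x + l y" if "x \<in> H1T T" "y \<in> H1T T" for x y
      using that H1T_add[OF T that] by (simp add: l_def lift_add add lift_H1T)
    show "l (a *\<^sub>R x) = a * l x" if "x \<in> H1T T" for a x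
      using that H1T_scaleR[OF T that] by (simp add: l_def lift_scaleR scale lift_H1T)
    obtain B where B: "\<And>v. v \<in> H1T T \<Longrightarrow> H1T_norm T (lift v) \<le> B * H1T_norm T v" using lift_bounded by blast
    have "\<bar>l x\<bar> \<le> (\<bar>C\<bar> * B) * H1T_norm T x" if x: "x \<in> H1T T" for x
    proof -
      have "\<bar>l x\<bar> \<le> C * H1T_norm T (lift x)" using x bdd[OF lift_H1T[OF x]] by (simp add: l_def)
      also have "\<dots> \<le> \<bar>C\<bar> * H1T_norm T (lift x)" by (intro mult_right_mono H1_norm_nonneg) simp
      also have "\<dots> \<le> \<bar>C\<bar> * (B * H1T_norm T x)" by (intro mult_left_mono B x) simp
      finally show ?thesis by (simp add: mult.assoc)
    qed
    then show "\<exists>C. \<forall>x\<in>H1T T. \<bar>l x\<bar> \<le> C * H1T_norm T x" by blast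
    show "l x = 0" if "x \<notin> H1T T" for x using that by (simp add: l_def)
  qed
  moreover have "l (z - Gp) \<le> 0" if z: "z \<in> K_cone T" for z
  proof -
    have zH: "z - Gp \<in> H1T T" using z by (intro H1T_diff[OF T] Gp_H1T) (simp add: K_cone_def)
    have "0 \<le> J (lift (z - Gp))"
    proof (rule lin[OF lift_H1T[OF zH], of 1])
      fix t assume t: "t \<in> {0..T}"
      \<comment> \<open>With step 1 the linearised constraint is the convex combination of
        g(\<gamma> t) and z(t) with weights \<omega> and 1 - \<omega>, both values being
        nonpositive.\<close>
      have "g (\<gamma> t) + DG (lift (z - Gp)) t = \<omega> (\<gamma> t) * g (\<gamma> t) + (1 - \<omega> (\<gamma> t)) * z t"
        using t by (simp add: DG_def lift_def inner_N Gp_def fun_diff_def algebra_simps)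
      also have "\<dots> \<le> 0"
        using \<omega>_bounds[of "\<gamma> t"] feasible[OF t] z t by (auto simp: K_cone_def intro!: add_nonpos_nonpos mult_nonneg_nonpos)
      finally show "g (\<gamma> t) + 1 * DG (lift (z - Gp)) t \<le> 0" by simp
    qed simp
    then show ?thesis using zH by (simp add: l_def)
  qed
  ultimately have "l \<in> normal_cone (H1T T) (H1T_norm T) (K_cone T) Gp" by (simp add: normal_cone_def)
  moreover have "J d + l (DG d) = 0" if d: "d \<in> H1T T" for d
  proof -
    let ?e = "d - lift (DG d)"
    have e: "?e \<in> H1T T" by (intro H1T_diff[OF T] d lift_H1T DG_H1T)
    obtain \<epsilon> where \<epsilon>: "0 < \<epsilon>" "\<And>t. t \<in> {0..T} \<Longrightarrow> g (\<gamma> t) + \<epsilon> * \<bar>rest (DG d) t\<bar> \<le> 0"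
      using rest_absorbed[OF DG_H1T[OF d]] by blast
    have "0 \<le> J (c *\<^sub>R ?e)" if c: "\<bar>c\<bar> = 1" for c
    proof (rule lin[OF H1T_scaleR[OF T e] \<epsilon>(1)])
      fix t assume t: "t \<in> {0..T}"
      have "DG (c *\<^sub>R ?e) t = c * rest (DG d) t"
        unfolding DG_diff_lift_DG[symmetric] by (simp add: DG_def scaleR_fun_def)
      also have "\<dots> \<le> \<bar>rest (DG d) t\<bar>" using abs_ge_self[of "c * rest (DG d) t"] c by (simp add: abs_mult)
      finally have "\<epsilon> * DG (c *\<^sub>R ?e) t \<le> \<epsilon> * \<bar>rest (DG d) t\<bar>" using \<epsilon>(1) by simp
      then show "g (\<gamma> t) + \<epsilon> * DG (c *\<^sub>R ?e) t \<le> 0" using \<epsilon>(2)[OF t] by linarith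
    qed
    from this[of 1, unfolded scale[OF e]] this[of "-1", unfolded scale[OF e]] have "J ?e = 0" by simp
    moreover have "J d = J (?e + lift (DG d))" by simp
    moreover have "\<dots> = J ?e + J (lift (DG d))" by (rule add[OF e lift_H1T[OF DG_H1T[OF d]]])
    ultimately show ?thesis using DG_H1T[OF d] by (simp add: l_def)
  qed
  ultimately show ?thesis by blast
qed

end

text \<open>\<open>D_cost\<close> picks a derivative by \<open>SOME\<close>; differentiability
  guarantees that there is one to pick, and being a bounded linear functional is part of being a
  derivative.\<close>

lemma reduced_cost_derivative_dual:
  assumes "reduced_cost_C1 D" "\<gamma> \<in> H1T (final_time D)" "\<tau> \<in> stop_times D"
  shows "D_cost D (\<gamma>, \<tau>) \<in> dual (H1R (final_time D)) (H1R_norm (final_time D))"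
proof -
  have "\<exists>f'. has_frechet_on (H1R (final_time D)) (H1R_norm (final_time D))
      (H1T (final_time D) \<times> stop_times D) (reduced_cost D) f' (\<gamma>, \<tau>)"
    using assms unfolding reduced_cost_C1_def cont_frechet_differentiable_on_def by blast
  from someI_ex[OF this] show ?thesis
    unfolding D_cost_def frechet_on_def by (simp add: has_frechet_on_def)
qed

theorem mainTheorem8:
  fixes D :: path_problem and \<gamma> :: "real \<Rightarrow> real^2" and \<tau> :: real
  assumes "standing_assumptions D"
    and "reduced_cost_C1 D"
    and "\<gamma> \<in> H1T (final_time D)"
  shows "(GG D (\<gamma>, \<tau>) \<in> KK D \<longleftrightarrow> \<gamma> \<in> U_ad D \<and> \<tau> \<in> {3 * window D..final_time D}) \<and>
    (GG D (\<gamma>, \<tau>) \<in> KK D \<longrightarrow>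
      H1R (final_time D) = minkowski_diff (DGG D (\<gamma>, \<tau>) ` H1R (final_time D))
        (radial_cone (KK D) (GG D (\<gamma>, \<tau>))) \<and>
      (first_order_conditions D (\<gamma>, \<tau>) \<longrightarrow>
        (\<exists>l \<mu>. lagrange_multiplier D (\<gamma>, \<tau>) (l, \<mu>) \<and>
          H1R (final_time D) = minkowski_diff (DGG D (\<gamma>, \<tau>) ` H1R (final_time D))
            (radial_cone (KK D) (GG D (\<gamma>, \<tau>)) \<inter> annihilator (final_time D) (l, \<mu>)) \<and>
          (\<forall>m. lagrange_multiplier D (\<gamma>, \<tau>) m \<longrightarrow> m = (l, \<mu>)))))"
proof -
  let ?T = "final_time D" and ?g = "level_fun D"
  let ?n = "gradient ?g"
  have T: "0 < ?T" and C3: "C_class 3 ?g"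
    and reg: "\<And>x. ?g x = 0 \<Longrightarrow> frechet_derivative ?g (at x) \<noteq> (\<lambda>_. 0)"
    using assms(1) unfolding standing_assumptions_def by auto
  have C: "C_class (Suc (Suc (Suc 0))) ?g" using C3 by (simp add: numeral_3_eq_3)
  have diff: "?g differentiable (at x)" for x using C by simp
  note g = C_class_has_C1_deriv_gradient[OF C]
  obtain n' where n: "has_C1_deriv ?n n'" using C_class_gradient_has_C1_deriv[OF C] by blast
  have regular: "?n x \<noteq> 0" if "?g x = 0" for x
  proof
    assume "?n x = 0"
    then have "frechet_derivative ?g (at x) h = 0" for h using inner_gradient[OF diff, of x h] by simp
    with reg[OF that] show False by blast
  qed
  have feas: "GG D (\<gamma>, \<tau>) \<in> KK D \<longleftrightarrow> \<gamma> \<in> U_ad D \<and> \<tau> \<in> {3 * window D..?T}"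
    using H1T_compose[OF T g assms(3)] assms(3)
    by (auto simp: GG_def KK_def K_cone_def U_ad_def G_con_def)
  show ?thesis
  proof (intro conjI feas impI)
    assume KK: "GG D (\<gamma>, \<tau>) \<in> KK D"
    then have \<gamma>U: "\<gamma> \<in> U_ad D" and \<tau>: "\<tau> \<in> stop_times D" using feas by auto
    interpret regular_constraint ?T ?g ?n n' \<gamma>
      by unfold_locales (use T g n regular assms(3) \<gamma>U in \<open>auto simp: U_ad_def\<close>)
    have G: "G_con D \<gamma> = Gp" by (simp add: G_con_def Gp_def)
    have DGc: "DG_con D \<gamma> d = DG d" for d by (simp add: DG_con_def DG_def inner_gradient[OF diff])
    have sub: "minkowski_diff (DGG D (\<gamma>, \<tau>) ` H1R ?T) (radial_cone (KK D) (GG D (\<gamma>, \<tau>))) \<subseteq> H1R ?T"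
      by (auto simp: minkowski_diff_def radial_cone_def KK_def K_cone_def DGG_def GG_def G DGc
          intro!: H1T_diff[OF T] H1T_scaleR[OF T] DG_H1T Gp_H1T)
    \<comment> \<open>The cone element is kept explicit: both Robinson conditions use this one
      decomposition, and the strict one only adds that (- rest v, 0) is annihilated. The time
      increment \<sigma> comes entirely from \<open>DGG\<close>, and the point of the cone keeps the
      time \<tau>.\<close>
    have decomp: "\<exists>a\<in>DGG D (\<gamma>, \<tau>) ` H1R ?T. \<exists>b. b \<in> radial_cone (KK D) (GG D (\<gamma>, \<tau>)) \<and>
        b = (- rest v, 0) \<and> (v, \<sigma>) = a - b" if v: "v \<in> H1T ?T" for v \<sigma>
    proof -
      obtain s z where sz: "0 \<le> s" "z \<in> K_cone ?T" "rest v = - (s *\<^sub>R (z - Gp))" using rest_radial[OF v] .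
      have "(z, \<tau>) \<in> KK D" using sz \<tau> by (simp add: KK_def)
      moreover have "(- rest v, 0) = s *\<^sub>R ((z, \<tau>) - GG D (\<gamma>, \<tau>))" by (simp add: GG_def G sz(3))
      ultimately have r: "(- rest v, 0) \<in> radial_cone (KK D) (GG D (\<gamma>, \<tau>))"
        unfolding radial_cone_def using sz(1) by blast
      have "DGG D (\<gamma>, \<tau>) (lift v, \<sigma>) = (DG (lift v), \<sigma>)" by (simp add: DGG_def DGc)
      moreover have "(v, \<sigma>) = (DG (lift v), \<sigma>) - (- rest v, 0)" by (simp add: DG_lift)
      ultimately show ?thesis using r lift_H1T[OF v] by (metis SigmaI UNIV_I imageI)
    qed
    show "H1R ?T = minkowski_diff (DGG D (\<gamma>, \<tau>) ` H1R ?T) (radial_cone (KK D) (GG D (\<gamma>, \<tau>)))"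
    proof (intro equalityI sub subsetI)
      fix y assume "y \<in> (H1R ?T :: ((real \<Rightarrow> real) \<times> real) set)"
      then show "y \<in> minkowski_diff (DGG D (\<gamma>, \<tau>) ` H1R ?T) (radial_cone (KK D) (GG D (\<gamma>, \<tau>)))"
        using decomp[of "fst y" "snd y"] unfolding minkowski_diff_def prod.collapse mem_Times_iff by blast
    qed
    assume foc: "first_order_conditions D (\<gamma>, \<tau>)"
    note dual = reduced_cost_derivative_dual[OF assms(2,3) \<tau>]
    let ?J = "D_gamma D (\<gamma>, \<tau>)"
    obtain B where B: "\<And>x. x \<in> H1R ?T \<Longrightarrow> \<bar>D_cost D (\<gamma>, \<tau>) x\<bar> \<le> B * H1R_norm ?T x"
      using dual unfolding dual_def by blast
    have "\<exists>l\<in>normal_cone (H1T ?T) (H1T_norm ?T) (K_cone ?T) Gp. \<forall>d\<in>H1T ?T. ?J d + l (DG d) = 0"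
    proof (rule multiplier_exists)
      fix x y :: "real \<Rightarrow> real^2" assume xy: "x \<in> H1T ?T" "y \<in> H1T ?T"
      have "D_cost D (\<gamma>, \<tau>) ((x, 0) + (y, 0)) = D_cost D (\<gamma>, \<tau>) (x, 0) + D_cost D (\<gamma>, \<tau>) (y, 0)"
        using dual xy by (simp only: dual_def mem_Collect_eq) (simp del: add_Pair)
      then show "?J (x + y) = ?J x + ?J y" by (simp add: D_gamma_def)
    next
      fix a and x :: "real \<Rightarrow> real^2" assume x: "x \<in> H1T ?T"
      have "D_cost D (\<gamma>, \<tau>) (a *\<^sub>R (x, 0)) = a * D_cost D (\<gamma>, \<tau>) (x, 0)"
        using dual x by (simp only: dual_def mem_Collect_eq) (simp del: scaleR_Pair)
      then show "?J (a *\<^sub>R x) = a * ?J x" by (simp add: D_gamma_def)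
    next
      fix x :: "real \<Rightarrow> real^2" assume x: "x \<in> H1T ?T"
      then show "\<bar>?J x\<bar> \<le> B * H1T_norm ?T x"
        using B[of "(x, 0)"] by (simp add: D_gamma_def H1R_norm_def H1_norm_nonneg)
    next
      fix d assume "d \<in> tangent_cone (H1T ?T) (H1T_norm ?T) {\<gamma> \<in> H1T ?T. \<forall>t\<in>{0..?T}. ?g (\<gamma> t) \<le> 0} \<gamma>"
      then show "0 \<le> ?J d" using foc by (simp add: first_order_conditions_def U_ad_def)
    qed
    then obtain l where l: "l \<in> normal_cone (H1T ?T) (H1T_norm ?T) (K_cone ?T) Gp"
      "\<forall>d\<in>H1T ?T. ?J d + l (DG d) = 0" by blast
    define \<mu> where "\<mu> = - D_tau D (\<gamma>, \<tau>)"
    \<comment> \<open>The normal cone inequality is the first-order condition in time with the sign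
      reversed; the absolute value of the time derivative is the bound required by
      \<open>dual\<close>.\<close>
    have "(\<lambda>s. \<mu> * s) \<in> normal_cone UNIV norm (stop_times D) \<tau>"
      using foc by (auto simp: normal_cone_def dual_def first_order_conditions_def \<mu>_def abs_mult algebra_simps
          intro!: exI[of _ "\<bar>D_tau D (\<gamma>, \<tau>)\<bar>"])
    then have "lagrange_multiplier D (\<gamma>, \<tau>) (l, \<mu>)"
      using l by (simp add: lagrange_multiplier_def G DGc) (simp add: \<mu>_def)
    moreover have "H1R ?T = minkowski_diff (DGG D (\<gamma>, \<tau>) ` H1R ?T)
        (radial_cone (KK D) (GG D (\<gamma>, \<tau>)) \<inter> annihilator ?T (l, \<mu>))"
    proof (intro equalityI subsetI)
      fix y assume y: "y \<in> (H1R ?T :: ((real \<Rightarrow> real) \<times> real) set)"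
      \<comment> \<open>\<mu> meets the time component 0, so the claim reduces to \<open>l\<close>
        vanishing on the rest.\<close>
      have "(- rest (fst y), 0) \<in> annihilator ?T (l, \<mu>)"
      proof -
        have r: "rest (fst y) \<in> H1T ?T" using y by (intro rest_H1T) auto
        have "\<forall>a. \<forall>x\<in>H1T ?T. l (a *\<^sub>R x) = a * l x" using l(1) unfolding normal_cone_def dual_def by blast
        from bspec[OF spec[OF this, of "-1"] r] have "l (- rest (fst y)) = - l (rest (fst y))" by simp
        moreover have "l (rest (fst y)) = 0" using y by (intro normal_cone_vanishes_on_rest[OF l(1)]) auto
        moreover have "- rest (fst y) \<in> H1T ?T" using H1T_scaleR[OF T r, of "-1"] by simp
        ultimately show ?thesis by (simp add: annihilator_def)
      qed
      then show "y \<in> minkowski_diff (DGG D (\<gamma>, \<tau>) ` H1R ?T)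
          (radial_cone (KK D) (GG D (\<gamma>, \<tau>)) \<inter> annihilator ?T (l, \<mu>))"
        using decomp[of "fst y" "snd y"] y unfolding minkowski_diff_def prod.collapse mem_Times_iff by blast
    next
      fix y assume "y \<in> minkowski_diff (DGG D (\<gamma>, \<tau>) ` H1R ?T)
          (radial_cone (KK D) (GG D (\<gamma>, \<tau>)) \<inter> annihilator ?T (l, \<mu>))"
      then show "y \<in> H1R ?T" using sub unfolding minkowski_diff_def by blast
    qed
    moreover have "m = (l, \<mu>)" if "lagrange_multiplier D (\<gamma>, \<tau>) m" for m
    proof -
      \<comment> \<open>The second component is forced by the stationarity equation in time, the
        first by uniqueness for the path constraint.\<close>
      have "fst m \<in> normal_cone (H1T ?T) (H1T_norm ?T) (K_cone ?T) Gp"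
        "\<forall>d\<in>H1T ?T. ?J d + fst m (DG d) = 0" "snd m = \<mu>"
        using that by (auto simp: lagrange_multiplier_def Let_def G DGc \<mu>_def split: prod.splits)
      then show ?thesis using multiplier_unique[OF _ _ l] by (simp add: prod_eq_iff)
    qed
    ultimately show "\<exists>l \<mu>. lagrange_multiplier D (\<gamma>, \<tau>) (l, \<mu>) \<and>
        H1R ?T = minkowski_diff (DGG D (\<gamma>, \<tau>) ` H1R ?T)
          (radial_cone (KK D) (GG D (\<gamma>, \<tau>)) \<inter> annihilator ?T (l, \<mu>)) \<and>
        (\<forall>m. lagrange_multiplier D (\<gamma>, \<tau>) m \<longrightarrow> m = (l, \<mu>))" by blast
  qed
qed

end
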